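(* Let $\lambda\in(0,1)$, let $\varphi(x)=\psi(\|x\|)$ for an increasing convex function $\psi:[0,\infty)\to(-\infty,\infty]$, and let $d\nu(x)=e^{-\varphi(x)}\,dx$ be the corresponding log-concave measure on $\mathbb{R}^n$. If $H_1,\ldots,H_n$ are linear hyperplanes of $\mathbb{R}^n$ with $H_1\cap\ldots\cap H_n=\{o\}$, and the convex bodies $K$ and $L$ in $\mathbb{R}^n$ are invariant under the orthogonal reflections through $H_1,\ldots,H_n$, then $$\nu((1-\lambda)\cdot K +_0 \lambda\cdot L)\geq \nu(K)^{1-\lambda}\, \nu(L)^\lambda .$$
   Context: A convex body in $\mathbb{R}^n$ is a compact convex set with non-empty interior; $o$ is the origin; $\|\cdot\|$ is the Euclidean norm; "increasing" is understood as non-decreasing, and $e^{-\infty}=0$. A set $X$ is invariant under a linear map $A$ if $AX=X$. The support function of a compact convex set $K$ is $h_K(u)=\max\{\langle u,y\rangle: y\in K\}$. For convex bodies $K,L$ with $o$ in their interiors (automatically the case under the invariance hypothesis of the claim), the $L_0$-sum is $$(1-\lambda)\cdot K+_0\lambda\cdot L=\{x\in\mathbb{R}^n:\langle x,u\rangle\leq h_K(u)^{1-\lambda}h_L(u)^{\lambda}\ \ \forall u\in S^{n-1}\}.$$ *)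

theory Defs
  imports "HOL-Analysis.Analysis"
begin

definition convex_body :: "'a::euclidean_space set \<Rightarrow> bool" where
  "convex_body K \<longleftrightarrow> compact K \<and> convex K \<and> interior K \<noteq> {}"

text \<open>For nonempty compact \<open>K\<close> the supremum is attained.\<close>

definition support_fun :: "'a::euclidean_space set \<Rightarrow> 'a \<Rightarrow> real" where
  "support_fun K u = (SUP y\<in>K. u \<bullet> y)"

text \<open>When the origin is an interior point of both sets, the support functions are positive
  on the unit sphere, so that \<open>powr\<close> is the usual power there.\<close>

definition L0_sum :: "real \<Rightarrow> 'a::euclidean_space set \<Rightarrow> 'a set \<Rightarrow> 'a set" where
  "L0_sum lam K L =
     {x. \<forall>u\<in>sphere 0 1. x \<bullet> u \<le> support_fun K u powr (1 - lam) * support_fun L u powr lam}"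

definition linear_hyperplane :: "'a::euclidean_space set \<Rightarrow> bool" where
  "linear_hyperplane H \<longleftrightarrow> (\<exists>a. a \<noteq> 0 \<and> H = {x. a \<bullet> x = 0})"

text \<open>On a linear subspace, \<open>closest_point\<close> is the orthogonal projection.\<close>

definition orth_reflection :: "'a::euclidean_space set \<Rightarrow> 'a \<Rightarrow> 'a" where
  "orth_reflection H x = 2 *\<^sub>R closest_point H x - x"

lemma orth_reflection_hyperplane:
  fixes a x :: "'a::euclidean_space"
  assumes "a \<noteq> 0"
  shows "orth_reflection {x. a \<bullet> x = 0} x = x - (2 * (a \<bullet> x) / (a \<bullet> a)) *\<^sub>R a"
proof -
  define p where "p = x - ((a \<bullet> x) / (a \<bullet> a)) *\<^sub>R a"
  have p: "a \<bullet> p = 0"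
    using assms by (simp add: p_def inner_diff_right)
  have "dist x p \<le> dist x z" if "a \<bullet> z = 0" for z
  proof -
    have "orthogonal (x - p) (p - z)"
      using p that by (simp add: orthogonal_def p_def inner_diff_right)
    then have "(norm (x - z))\<^sup>2 = (norm (x - p))\<^sup>2 + (norm (p - z))\<^sup>2"
      using norm_add_Pythagorean by fastforce
    then have "(norm (x - p))\<^sup>2 \<le> (norm (x - z))\<^sup>2"
      by simp
    then show ?thesis
      by (simp add: dist_norm)
  qed
  then have "closest_point {x. a \<bullet> x = 0} x = p"
    using p by (intro closest_point_unique[symmetric] convex_hyperplane closed_hyperplane) auto
  then have "orth_reflection {x. a \<bullet> x = 0} x = 2 *\<^sub>R p - x"
    by (simp add: orth_reflection_def)
  also have "\<dots> = x - (2 * (a \<bullet> x) / (a \<bullet> a)) *\<^sub>R a"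
    by (simp add: p_def scaleR_diff_right scaleR_2)
  finally show ?thesis .
qed

text \<open>Convexity of a function with values in \<open>(-\<infinity>, \<infinity>]\<close>; as \<open>t\<close> ranges over the open unit
  interval, no products of \<open>0\<close> and \<open>\<infinity>\<close> occur.\<close>

definition ext_convex_on :: "'a::real_vector set \<Rightarrow> ('a \<Rightarrow> ereal) \<Rightarrow> bool" where
  "ext_convex_on S f \<longleftrightarrow> convex S \<and> (\<forall>x\<in>S. f x \<noteq> -\<infinity>) \<and>
     (\<forall>x\<in>S. \<forall>y\<in>S. \<forall>t\<in>{0<..<1}.
        f ((1 - t) *\<^sub>R x + t *\<^sub>R y) \<le> ereal (1 - t) * f x + ereal t * f y)"

definition exp_neg :: "ereal \<Rightarrow> ennreal" where
  "exp_neg s = (case s of ereal r \<Rightarrow> ennreal (exp (- r)) | PInfty \<Rightarrow> 0 | MInfty \<Rightarrow> \<infinity>)"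

definition radial_measure :: "(real \<Rightarrow> ereal) \<Rightarrow> 'a::euclidean_space measure" where
  "radial_measure \<psi> = density lborel (\<lambda>x. exp_neg (\<psi> (norm x)))"

text \<open>Sanity check: the densities considered are Borel functions, and bounded sets have finite
  measure, so that the real-valued \<open>measure\<close> may be used for convex bodies.\<close>

lemma antimono_exp_neg: "s \<le> t \<Longrightarrow> exp_neg t \<le> exp_neg s"
  by (cases s; cases t) (auto simp: exp_neg_def)

lemma borel_measurable_exp_neg_norm:
  fixes \<psi> :: "real \<Rightarrow> ereal"
  assumes "mono_on {0..} \<psi>"
  shows "(\<lambda>x::'a::euclidean_space. exp_neg (\<psi> (norm x))) \<in> borel_measurable borel"
proof -
  define g where "g = (\<lambda>t. \<psi> (max 0 t))"
  have "mono g"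
    using assms by (auto simp: g_def mono_on_def intro!: monoI)
  have [measurable]: "g \<in> borel_measurable borel"
  proof (rule borel_measurableI_le)
    fix y
    have "is_interval {t. g t \<le> y}"
      using \<open>mono g\<close> unfolding is_interval_1 by (auto dest: monoD intro: order_trans)
    then show "{t \<in> space borel. g t \<le> y} \<in> sets borel"
      using real_interval_borel_measurable by simp
  qed
  have [measurable]: "exp_neg \<in> borel_measurable borel"
  proof -
    have *: "exp_neg = (\<lambda>s. if s = \<infinity> then 0 else if s = -\<infinity> then \<infinity> else ennreal (exp (- real_of_ereal s)))"
    proof
      fix s show "exp_neg s = (if s = \<infinity> then 0 else if s = -\<infinity> then \<infinity>
          else ennreal (exp (- real_of_ereal s)))"
        by (cases s) (auto simp: exp_neg_def)
    qed
    show ?thesis unfolding * by measurable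
  qed
  have "(\<lambda>x::'a. exp_neg (g (norm x))) \<in> borel_measurable borel"
    by measurable
  then show ?thesis by (simp add: g_def)
qed

lemma emeasure_radial_measure_bounded:
  fixes A :: "'a::euclidean_space set"
  assumes "mono_on {0..} \<psi>" "\<psi> 0 \<noteq> -\<infinity>" "bounded A" "A \<in> sets borel"
  shows "emeasure (radial_measure \<psi>) A < \<infinity>"
proof -
  have fin: "exp_neg (\<psi> 0) < \<infinity>"
    using assms(2) by (cases "\<psi> 0") (auto simp: exp_neg_def)
  have "emeasure (radial_measure \<psi>) A = (\<integral>\<^sup>+x. exp_neg (\<psi> (norm x)) * indicator A x \<partial>lborel)"
    unfolding radial_measure_def using assms borel_measurable_exp_neg_norm[OF assms(1)]
    by (subst emeasure_density) auto
  also have "\<dots> \<le> (\<integral>\<^sup>+x. exp_neg (\<psi> 0) * indicator A x \<partial>lborel)"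
    using assms(1) by (intro nn_integral_mono mult_right_mono antimono_exp_neg) (auto simp: mono_on_def)
  also have "\<dots> = exp_neg (\<psi> 0) * emeasure lborel A"
    using assms(4) by (simp add: nn_integral_cmult_indicator)
  also have "\<dots> < \<infinity>"
    using fin emeasure_bounded_finite[OF assms(3)] by (simp add: ennreal_mult_less_top)
  finally show ?thesis .
qed

end

theory Submission
  imports Defs
begin

text \<open>The unit vectors whose reflections preserve \<open>K\<close> and \<open>L\<close> form a closed set \<open>S\<close> that spans the
  space and is stable under its own reflections. If \<open>S\<close> is infinite, it contains a circle, and a
  vector \<open>u\<close> of that circle can be split off orthogonally; so \<open>S\<close> has a finite spanning subset
  \<open>R\<close> with the same stability. A chamber of \<open>R\<close> is a simplicial cone whose edges pairwise make
  non-obtuse angles, and for every invariant set the proportion of its measure lying in the chamber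
  is the same constant. In coordinates along the edges, the coordinatewise geometric mean \<open>z\<close> of
  \<open>x \<in> K\<close> and \<open>y \<in> L\<close> in the chamber satisfies, by Hoelder's inequality,
  \<open>\<langle>z, u\<rangle> \<le> \<langle>x, u\<rangle>\<^sup>1\<^sup>-\<^sup>\<lambda> \<langle>y, u\<rangle>\<^sup>\<lambda>\<close> for all \<open>u\<close> in the closed chamber. As \<open>\<langle>z, u\<rangle>\<close> does not decrease when
  \<open>u\<close> is moved into the chamber by the group, \<open>z\<close> lies in the \<open>L\<^sub>0\<close>-sum. Since also
  \<open>\<parallel>z\<parallel> \<le> (1 - \<lambda>) \<parallel>x\<parallel> + \<lambda> \<parallel>y\<parallel>\<close>, the multiplicative Prekopa--Leindler inequality on the positive
  orthant gives the claim.\<close>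

section \<open>The Prekopa--Leindler inequality\<close>

text \<open>The given normals cannot serve as \<open>R\<close>: closing them under reflections may
  produce an infinite set, as for two lines whose angle is an irrational multiple of pi when
  \<open>K\<close> and \<open>L\<close> are discs. Hence the detour through all common symmetries
  and the descent to a finite subsystem, which may lose the given normals. Only the span has to
  survive: it makes the chamber simplicial and the stabilizer of \<open>R\<close> finite. The group
  used is the whole stabilizer of \<open>R\<close>, \<open>K\<close> and \<open>L\<close>; it may
  contain symmetries of the chamber itself, so a constant multiplicity takes the place of simple
  transitivity. The angles between the edges matter for signs: in edge coordinates the inner product
  of \<open>z\<close> and \<open>u\<close> is a sum weighted by the products of the edges with
  \<open>u\<close>, and Hoelder's inequality needs these weights nonnegative, which holds only for
  \<open>u\<close> in suitable cones such as the closed chamber. The logarithmic substitution behind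
  the multiplicative inequality costs nothing, its Jacobian being multiplicative itself, and the
  linear change of coordinates contributes one positive factor to all three measures, which
  cancels.\<close>

lemma emeasure_lborel_le_compact:
  fixes A :: "real set"
  assumes A: "A \<in> sets borel" "A \<noteq> {}"
    and bound: "\<And>P. compact P \<Longrightarrow> P \<subseteq> A \<Longrightarrow> P \<noteq> {} \<Longrightarrow> emeasure lborel P + d \<le> (Z::ennreal)"
  shows "emeasure lborel A + d \<le> Z"
proof -
  obtain a where a: "a \<in> A" using A by auto
  have fin: "emeasure lborel (A \<inter> {-real n..real n}) + d \<le> Z" for n
  proof (rule ennreal_le_epsilon)
    fix e :: real assume "0 < e"
    define D where "D = A \<inter> {-real n..real n}"
    have D[measurable]: "D \<in> sets borel" using A by (auto simp: D_def)
    then have "D \<in> sets lebesgue" by simp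
    then obtain T where T: "closed T" "T \<subseteq> D" "D - T \<in> lmeasurable" "emeasure lebesgue (D - T) < ennreal e"
      using sets_lebesgue_inner_closed \<open>0 < e\<close> by blast
    have [measurable]: "T \<in> sets borel" using T by auto
    have "bounded D" unfolding D_def by (meson bounded_closed_interval bounded_Int)
    \<comment> \<open>\<open>T\<close> may be empty, while \<open>bound\<close> speaks of nonempty
      sets; adding a point \<open>a\<close> of \<open>A\<close> repairs this and keeps the set
      inside \<open>A\<close>.\<close>
    then have "compact (insert a T)"
      using T by (auto simp: compact_eq_bounded_closed intro: bounded_subset)
    moreover have "insert a T \<subseteq> A" using T a D_def by auto
    ultimately have Z: "emeasure lborel (insert a T) + d \<le> Z"
      by (intro bound) auto
    have "emeasure lborel D \<le> emeasure lborel T + emeasure lborel (D - T)"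
      using emeasure_subadditive[of T lborel "D - T"] T(2) by (simp add: Un_absorb1)
    also have "\<dots> \<le> emeasure lborel (insert a T) + ennreal e"
    proof (rule add_mono)
      show "emeasure lborel T \<le> emeasure lborel (insert a T)" by (intro emeasure_mono) auto
      have "emeasure lborel (D - T) = emeasure lebesgue (D - T)"
        by (simp add: emeasure_completion)
      then show "emeasure lborel (D - T) \<le> ennreal e" using T by auto
    qed
    finally have "emeasure lborel D + d \<le> (emeasure lborel (insert a T) + d) + ennreal e"
      by (simp add: add.commute add.left_commute add_left_mono)
    also have "\<dots> \<le> Z + ennreal e" using Z by (intro add_right_mono)
    finally show "emeasure lborel (A \<inter> {-real n..real n}) + d \<le> Z + ennreal e"
      by (simp add: D_def)
  qed
  have "emeasure lborel A = (SUP n. emeasure lborel (A \<inter> {-real n..real n}))"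
  proof (subst SUP_emeasure_incseq)
    show "range (\<lambda>n. A \<inter> {-real n..real n}) \<subseteq> sets lborel" using A by auto
    show "incseq (\<lambda>n. A \<inter> {-real n..real n})" by (auto simp: incseq_def)
    have "(\<Union>n. A \<inter> {-real n..real n}) = A"
    proof -
      { fix x assume "x \<in> A"
        obtain n where "\<bar>x\<bar> \<le> real n" using real_arch_simple by blast
        then have "x \<in> {-real n..real n}" by auto
        then have "\<exists>n. x \<in> {-real n..real n}" by blast }
      then show ?thesis by auto
    qed
    then show "emeasure lborel A = emeasure lborel (\<Union>n. A \<inter> {-real n..real n})" by simp
  qed
  then have "emeasure lborel A + d = (SUP n. emeasure lborel (A \<inter> {-real n..real n}) + d)"
    by (simp add: ennreal_SUP_add_left)
  also have "\<dots> \<le> Z" using fin by (intro SUP_least) auto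
  finally show ?thesis .
qed

lemma emeasure_lborel_translation_real:
  fixes P :: "real set"
  assumes "P \<in> sets borel"
  shows "emeasure lborel ((+) c ` P) = emeasure lborel P"
proof -
  have "emeasure lborel ((+) c ` P) = emeasure (distr lborel borel ((+) (-c))) P"
  proof (subst emeasure_distr)
    have "(+) c ` P = (+) (-c) -` P" by (auto simp: image_iff) (metis add.commute add_diff_cancel_left' diff_add_cancel add_uminus_conv_diff)
    then show "emeasure lborel ((+) c ` P) = emeasure lborel ((+) (-c) -` P \<inter> space lborel)" by simp
  qed (use assms in auto)
  then show ?thesis by (simp only: lborel_distr_plus)
qed

text \<open>The translates \<open>P + Min Q\<close> and \<open>Max P + Q\<close> share only one point.\<close>

lemma brunn_minkowski_real_compact:
  fixes P Q C :: "real set"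
  assumes "compact P" "P \<noteq> {}" "compact Q" "Q \<noteq> {}" and C: "C \<in> sets borel"
    and sub: "\<And>x y. x \<in> P \<Longrightarrow> y \<in> Q \<Longrightarrow> x + y \<in> C"
  shows "emeasure lborel P + emeasure lborel Q \<le> emeasure lborel C"
proof -
  obtain p where p: "p \<in> P" "\<And>x. x \<in> P \<Longrightarrow> x \<le> p" using compact_attains_sup assms by metis
  obtain q where q: "q \<in> Q" "\<And>x. x \<in> Q \<Longrightarrow> q \<le> x" using compact_attains_inf assms by metis
  have b[measurable]: "P \<in> sets borel" "Q \<in> sets borel" using assms by (auto intro: borel_closed compact_imp_closed)
  have t[measurable]: "(+) q ` P \<in> sets borel" "(+) p ` Q \<in> sets borel"
    using assms by (auto intro!: borel_closed compact_imp_closed compact_translation)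
  have "emeasure lborel P + emeasure lborel Q = emeasure lborel ((+) q ` P) + emeasure lborel ((+) p ` Q)"
    by (simp add: emeasure_lborel_translation_real)
  also have "emeasure lborel ((+) p ` Q) = emeasure lborel ((+) p ` Q - {p + q})"
    by (subst emeasure_Diff_null_set) (auto simp: null_sets_def)
  also have "emeasure lborel ((+) q ` P) + emeasure lborel ((+) p ` Q - {p + q}) =
      emeasure lborel ((+) q ` P \<union> ((+) p ` Q - {p + q}))"
  proof (subst plus_emeasure)
    show "(+) q ` P \<inter> ((+) p ` Q - {p + q}) = {}"
    proof (rule ccontr)
      assume "\<not> ?thesis"
      then obtain x y where xy: "x \<in> P" "y \<in> Q" "q + x = p + y" "q + x \<noteq> p + q" by auto
      then show False using p(2)[of x] q(2)[of y] by linarith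
    qed
  qed auto
  also have "\<dots> \<le> emeasure lborel C"
  proof (rule emeasure_mono)
    show "(+) q ` P \<union> ((+) p ` Q - {p + q}) \<subseteq> C"
      using sub[OF _ q(1)] sub[OF p(1)] by (auto simp: add.commute)
  qed (use C in auto)
  finally show ?thesis .
qed

text \<open>Inner approximation treats one summand at a time; the measure of the other one sits in
  the spectator term \<open>d\<close> of \<open>emeasure_lborel_le_compact\<close>.\<close>

lemma brunn_minkowski_real:
  fixes A B C :: "real set"
  assumes A: "A \<in> sets borel" "A \<noteq> {}" and B: "B \<in> sets borel" "B \<noteq> {}" and C: "C \<in> sets borel"
    and sub: "\<And>x y. x \<in> A \<Longrightarrow> y \<in> B \<Longrightarrow> x + y \<in> C"
  shows "emeasure lborel A + emeasure lborel B \<le> emeasure lborel C"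
proof (rule emeasure_lborel_le_compact[OF A])
  fix P assume P: "compact P" "P \<subseteq> A" "P \<noteq> {}"
  have "emeasure lborel B + emeasure lborel P \<le> emeasure lborel C"
  proof (rule emeasure_lborel_le_compact[OF B])
    fix Q assume Q: "compact Q" "Q \<subseteq> B" "Q \<noteq> {}"
    show "emeasure lborel Q + emeasure lborel P \<le> emeasure lborel C"
      using brunn_minkowski_real_compact[OF P(1,3) Q(1,3) C] sub P(2) Q(2)
      by (auto simp: add.commute)
  qed
  then show "emeasure lborel P + emeasure lborel B \<le> emeasure lborel C" by (simp add: add.commute)
qed

lemma emeasure_lborel_vimage_cmult_real:
  fixes A :: "real set"
  assumes A[measurable]: "A \<in> sets borel" and c: "0 < c"
  shows "emeasure lborel ((\<lambda>x. x / c) -` A) = ennreal c * emeasure lborel A"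
proof -
  have [measurable]: "(\<lambda>x. x / c) -` A \<in> sets borel" using measurable_sets_borel[of "\<lambda>x. x / c" borel A] A by simp
  have "emeasure lborel ((\<lambda>x. x / c) -` A) = (\<integral>\<^sup>+x. indicator ((\<lambda>x. x / c) -` A) x \<partial>lborel)"
    by simp
  also have "\<dots> = ennreal \<bar>c\<bar> * (\<integral>\<^sup>+x. indicator ((\<lambda>x. x / c) -` A) (0 + c * x) \<partial>lborel)"
    using c by (subst nn_integral_real_affine[where c=c and t=0]) auto
  also have "(\<lambda>x. indicator ((\<lambda>x. x / c) -` A) (0 + c * x)) = (indicator A :: real \<Rightarrow> ennreal)"
    using c by (auto simp: indicator_def fun_eq_iff)
  finally show ?thesis using c by simp
qed

lemma brunn_minkowski_real_convex:
  fixes A B C :: "real set" and l :: real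
  assumes A: "A \<in> sets borel" "A \<noteq> {}" and B: "B \<in> sets borel" "B \<noteq> {}" and C: "C \<in> sets borel"
    and l: "0 < l" "l < 1"
    and sub: "\<And>x y. x \<in> A \<Longrightarrow> y \<in> B \<Longrightarrow> (1 - l) * x + l * y \<in> C"
  shows "ennreal (1 - l) * emeasure lborel A + ennreal l * emeasure lborel B \<le> emeasure lborel C"
proof -
  \<comment> \<open>The dilates of \<open>A\<close> by \<open>1 - l\<close> and of \<open>B\<close>
    by \<open>l\<close>, written as preimages so that they are Borel sets at once.\<close>
  let ?A = "(\<lambda>x. x / (1 - l)) -` A" and ?B = "(\<lambda>x. x / l) -` B"
  have "?A \<in> sets borel" "?B \<in> sets borel"
    using measurable_sets_borel[of "\<lambda>x. x / (1-l)" borel A] measurable_sets_borel[of "\<lambda>x. x / l" borel B] A B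
    by simp_all
  moreover obtain a b where "a \<in> A" "b \<in> B" using A B by auto
  then have "(1 - l) * a \<in> ?A" "l * b \<in> ?B" using l by auto
  then have "?A \<noteq> {}" "?B \<noteq> {}" by blast+
  ultimately have "emeasure lborel ?A + emeasure lborel ?B \<le> emeasure lborel C"
  proof (intro brunn_minkowski_real)
    fix x y assume "x \<in> ?A" "y \<in> ?B"
    then show "x + y \<in> C" using sub[of "x / (1-l)" "y / l"] l by simp
  qed (use C in auto)
  then show ?thesis using A B l by (simp add: emeasure_lborel_vimage_cmult_real)
qed

section \<open>The Prekopa--Leindler inequality on the line\<close>

text \<open>Levels are measured as fractions \<open>t\<close> of the bound \<open>A\<close>.
  Functions with different bounds thereby share one parameter in the unit interval, at which their
  superlevel sets can be compared.\<close>

lemma nn_integral_layer_cake_bounded: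
  fixes f :: "real \<Rightarrow> ennreal"
  assumes [measurable]: "f \<in> borel_measurable borel" and A: "0 < A" and bnd: "\<And>x. f x \<le> ennreal A"
  shows "(\<integral>\<^sup>+x. f x \<partial>lborel) =
    ennreal A * (\<integral>\<^sup>+t. indicator {0<..<1} t * emeasure lborel {x. ennreal (A * t) < f x} \<partial>lborel)"
proof -
  have inner: "f x = ennreal A * (\<integral>\<^sup>+t. indicator {0<..<1} t * indicator {x. ennreal (A * t) < f x} x \<partial>lborel)" for x
  proof -
    obtain r where r: "f x = ennreal r" "0 \<le> r" "r \<le> A"
      using bnd[of x] A by (cases "f x") (auto simp: top_unique)
    have "(\<integral>\<^sup>+t. indicator {0<..<1} t * indicator {x. ennreal (A * t) < f x} x \<partial>lborel)
        = (\<integral>\<^sup>+t. indicator {0<..<r / A} t \<partial>lborel)"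
    proof (intro nn_integral_cong)
      fix t :: real
      have "A * t < r \<Longrightarrow> t < 1"
        using A r by (metis le_less_trans less_le_trans mult.right_neutral mult_less_cancel_left_pos)
      then show "(indicator {0<..<1} t * indicator {x. ennreal (A * t) < f x} x :: ennreal) = indicator {0<..<r / A} t"
        using A r by (auto simp: indicator_def ennreal_less_iff pos_less_divide_eq mult.commute)
    qed
    also have "\<dots> = ennreal (r / A)" using A r by simp
    finally show ?thesis using A r by (simp flip: ennreal_mult)
  qed
  have "(\<integral>\<^sup>+x. f x \<partial>lborel) = ennreal A * (\<integral>\<^sup>+x. \<integral>\<^sup>+t. indicator {0<..<1} t * indicator {x. ennreal (A * t) < f x} x \<partial>lborel \<partial>lborel)"
    by (subst inner, subst nn_integral_cmult) auto
  also have "(\<integral>\<^sup>+x. \<integral>\<^sup>+t. indicator {0<..<1} t * indicator {x. ennreal (A * t) < f x} x \<partial>lborel \<partial>lborel)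
     = (\<integral>\<^sup>+t. \<integral>\<^sup>+x. indicator {0<..<1} t * indicator {x. ennreal (A * t) < f x} x \<partial>lborel \<partial>lborel)"
    by (rule lborel_pair.Fubini') (simp add: split_def)
  also have "\<dots> = (\<integral>\<^sup>+t. indicator {0<..<1} t * emeasure lborel {x. ennreal (A * t) < f x} \<partial>lborel)"
    by (simp add: nn_integral_cmult)
  finally show ?thesis .
qed

text \<open>Only an inequality, as \<open>h\<close> may exceed \<open>c\<close>. The superlevel sets
  are not strict here because \<open>gm_le\<close> yields a non-strict lower bound for
  \<open>h\<close>.\<close>

lemma nn_integral_layer_cake_ge:
  fixes h :: "real \<Rightarrow> ennreal"
  assumes [measurable]: "h \<in> borel_measurable borel" and c: "0 < c"
  shows "ennreal c * (\<integral>\<^sup>+t. indicator {0<..<1} t * emeasure lborel {x. ennreal (c * t) \<le> h x} \<partial>lborel)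
    \<le> (\<integral>\<^sup>+x. h x \<partial>lborel)"
proof -
  have inner: "ennreal c * (\<integral>\<^sup>+t. indicator {0<..<1} t * indicator {x. ennreal (c * t) \<le> h x} x \<partial>lborel) \<le> h x" for x
  proof (cases "h x")
    case (real r)
    have "(\<integral>\<^sup>+t. indicator {0<..<1} t * indicator {x. ennreal (c * t) \<le> h x} x \<partial>lborel)
        \<le> (\<integral>\<^sup>+t. indicator {0<..r / c} t \<partial>lborel)"
      using c real by (intro nn_integral_mono) (auto simp: indicator_def ennreal_le_iff field_simps)
    also have "\<dots> = ennreal (r / c)" using c real by simp
    finally have "ennreal c * (\<integral>\<^sup>+t. indicator {0<..<1} t * indicator {x. ennreal (c * t) \<le> h x} x \<partial>lborel)
       \<le> ennreal c * ennreal (r / c)" by (rule mult_left_mono) simp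
    also have "\<dots> = h x" using c real by (simp flip: ennreal_mult)
    finally show ?thesis .
  qed simp
  have "(\<integral>\<^sup>+t. indicator {0<..<1} t * emeasure lborel {x. ennreal (c * t) \<le> h x} \<partial>lborel)
    = (\<integral>\<^sup>+t. \<integral>\<^sup>+x. indicator {0<..<1} t * indicator {x. ennreal (c * t) \<le> h x} x \<partial>lborel \<partial>lborel)"
    by (simp add: nn_integral_cmult)
  also have "\<dots> = (\<integral>\<^sup>+x. \<integral>\<^sup>+t. indicator {0<..<1} t * indicator {x. ennreal (c * t) \<le> h x} x \<partial>lborel \<partial>lborel)"
    by (rule lborel_pair.Fubini') (simp add: split_def)
  finally have "ennreal c * (\<integral>\<^sup>+t. indicator {0<..<1} t * emeasure lborel {x. ennreal (c * t) \<le> h x} \<partial>lborel)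
    = (\<integral>\<^sup>+x. ennreal c * (\<integral>\<^sup>+t. indicator {0<..<1} t * indicator {x. ennreal (c * t) \<le> h x} x \<partial>lborel) \<partial>lborel)"
    by (subst nn_integral_cmult) auto
  also have "\<dots> \<le> (\<integral>\<^sup>+x. h x \<partial>lborel)" using inner by (intro nn_integral_mono) auto
  finally show ?thesis .
qed

text \<open>Expresses \<open>p\<^sup>1\<^sup>-\<^sup>l q\<^sup>l \<le> r\<close> for extended values without a power on \<open>ennreal\<close>; by the
  strict inequalities it passes to suprema of \<open>p\<close> and \<open>q\<close>, and it is void if \<open>p = 0\<close> or \<open>q = 0\<close>.\<close>

definition gm_le :: "real \<Rightarrow> ennreal \<Rightarrow> ennreal \<Rightarrow> ennreal \<Rightarrow> bool" where
  "gm_le l p q r \<longleftrightarrow> (\<forall>a>0. \<forall>b>0. ennreal a < p \<longrightarrow> ennreal b < q \<longrightarrow>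
     ennreal (a powr (1 - l) * b powr l) \<le> r)"

lemma gm_leI:
  "(\<And>a b. 0 < a \<Longrightarrow> 0 < b \<Longrightarrow> ennreal a < p \<Longrightarrow> ennreal b < q \<Longrightarrow>
     ennreal (a powr (1 - l) * b powr l) \<le> r) \<Longrightarrow> gm_le l p q r"
  by (simp add: gm_le_def)

lemma gm_leD:
  "gm_le l p q r \<Longrightarrow> 0 < a \<Longrightarrow> 0 < b \<Longrightarrow> ennreal a < p \<Longrightarrow> ennreal b < q \<Longrightarrow>
     ennreal (a powr (1 - l) * b powr l) \<le> r"
  by (simp add: gm_le_def)

lemma gm_le_zero [simp]: "gm_le l 0 q r" "gm_le l p 0 r"
  by (auto simp: gm_le_def)

lemma gm_le_mono: "gm_le l p q r \<Longrightarrow> p' \<le> p \<Longrightarrow> q' \<le> q \<Longrightarrow> r \<le> r' \<Longrightarrow> gm_le l p' q' r'"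
  unfolding gm_le_def by (meson less_le_trans order_trans)

lemma ennreal_less_mult_divide:
  assumes "0 < \<alpha>" "ennreal a < ennreal \<alpha> * p"
  shows "ennreal (a / \<alpha>) < p"
proof (cases p)
  case (real r)
  then have "0 \<le> a \<Longrightarrow> a < \<alpha> * r" using assms by (simp add: ennreal_less_iff flip: ennreal_mult)
  moreover have "r > 0" using assms real by (cases "r = 0") auto
  ultimately show ?thesis using assms(1) real
    by (cases "0 \<le> a") (auto simp: ennreal_less_iff field_simps ennreal_neg divide_neg_pos not_le)
qed simp

text \<open>Homogeneity of the geometric mean; Jacobian factors and normalisations enter through
  this rule.\<close>

lemma gm_le_scale:
  assumes "gm_le l p q r" "0 < \<alpha>" "0 < \<beta>"
  shows "gm_le l (ennreal \<alpha> * p) (ennreal \<beta> * q) (ennreal (\<alpha> powr (1 - l) * \<beta> powr l) * r)"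
proof (rule gm_leI)
  fix a b :: real assume ab: "0 < a" "0 < b" "ennreal a < ennreal \<alpha> * p" "ennreal b < ennreal \<beta> * q"
  have "ennreal ((a / \<alpha>) powr (1 - l) * (b / \<beta>) powr l) \<le> r"
    using assms ab by (intro gm_leD[OF assms(1)] ennreal_less_mult_divide) auto
  then have "ennreal (\<alpha> powr (1 - l) * \<beta> powr l) * ennreal ((a / \<alpha>) powr (1 - l) * (b / \<beta>) powr l)
     \<le> ennreal (\<alpha> powr (1 - l) * \<beta> powr l) * r" by (rule mult_left_mono) simp
  moreover have "(\<alpha> powr (1 - l) * \<beta> powr l) * ((a / \<alpha>) powr (1 - l) * (b / \<beta>) powr l) = a powr (1 - l) * b powr l"
    using assms ab by (simp add: powr_divide)
  ultimately show "ennreal (a powr (1 - l) * b powr l) \<le> ennreal (\<alpha> powr (1 - l) * \<beta> powr l) * r"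
    by (simp flip: ennreal_mult)
qed

text \<open>Relative to the suprema \<open>A\<close> and \<open>B\<close>, the superlevel sets of
  \<open>f\<close> and \<open>g\<close> at the same fraction \<open>t < 1\<close> are nonempty, so
  Brunn--Minkowski applies at every level. Integration over \<open>t\<close> gives the arithmetic
  mean of the normalised integrals, which dominates their geometric mean.\<close>

lemma prekopa_leindler_bounded:
  fixes f g h :: "real \<Rightarrow> ennreal"
  assumes [measurable]: "f \<in> borel_measurable borel" "g \<in> borel_measurable borel" "h \<in> borel_measurable borel"
    and l: "0 < l" "l < 1"
    and bnd: "\<And>x. f x \<le> ennreal A'" "\<And>x. g x \<le> ennreal B'"
    and gm: "\<And>x y. gm_le l (f x) (g y) (h ((1 - l) * x + l * y))"
  shows "gm_le l (\<integral>\<^sup>+x. f x \<partial>lborel) (\<integral>\<^sup>+x. g x \<partial>lborel) (\<integral>\<^sup>+x. h x \<partial>lborel)"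
proof (rule gm_leI)
  fix a b :: real assume ab: "0 < a" "0 < b" "ennreal a < integral\<^sup>N lborel f" "ennreal b < integral\<^sup>N lborel g"
  have sup: "\<exists>A>0. (SUP x. f x) = ennreal A" if "\<And>x. f x \<le> ennreal A'" "0 < integral\<^sup>N lborel f"
    for f :: "real \<Rightarrow> ennreal" and A'
  proof -
    have "(SUP x. f x) \<le> ennreal A'" using that by (intro SUP_least)
    then obtain A where A: "0 \<le> A" "(SUP x. f x) = ennreal A"
      by (metis ennreal_cases ennreal_neq_top top_unique)
    have "A \<noteq> 0"
    proof
      assume "A = 0"
      then have "f x = 0" for x using A SUP_upper[of x UNIV f] by (metis UNIV_I ennreal_0 le_zero_eq)
      then have "f = (\<lambda>_. 0)" by (rule ext)
      then have "integral\<^sup>N lborel f = 0" using nn_integral_const[of lborel "0::ennreal"] by simp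
      with that(2) show False by (metis less_irrefl)
    qed
    with A(1) have "0 < A" by linarith
    with A(2) show ?thesis by blast
  qed
  have pos: "0 < integral\<^sup>N lborel f" "0 < integral\<^sup>N lborel g"
    using le_less_trans[OF zero_le ab(3)] le_less_trans[OF zero_le ab(4)] by simp_all
  obtain A where A: "0 < A" "(SUP x. f x) = ennreal A" using sup[OF bnd(1) pos(1)] by blast
  obtain B where B: "0 < B" "(SUP x. g x) = ennreal B" using sup[OF bnd(2) pos(2)] by blast
  have fA: "f x \<le> ennreal A" and gB: "g x \<le> ennreal B" for x
    using SUP_upper[of x UNIV f] SUP_upper[of x UNIV g] unfolding A(2) B(2) by simp_all
  \<comment> \<open>The levels \<open>A * t\<close> and \<open>B * t\<close> have geometric mean
    \<open>c * t\<close>, the level that \<open>h\<close> reaches.\<close>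
  define c where "c = A powr (1 - l) * B powr l"
  have c: "0 < c" using A B by (simp add: c_def)
  define F where "F = (\<lambda>t. emeasure lborel {x. ennreal (A * t) < f x})"
  define G where "G = (\<lambda>t. emeasure lborel {x. ennreal (B * t) < g x})"
  define U where "U = (\<lambda>t. emeasure lborel {x. ennreal (c * t) \<le> h x})"
  have [measurable]: "F \<in> borel_measurable borel" "G \<in> borel_measurable borel" "U \<in> borel_measurable borel"
    unfolding F_def G_def U_def by measurable
  have level: "ennreal (1 - l) * F t + ennreal l * G t \<le> U t" if t: "0 < t" "t < 1" for t
    unfolding F_def G_def U_def
  proof (rule brunn_minkowski_real_convex)
    have "ennreal (A * t) < (SUP x. f x)" "ennreal (B * t) < (SUP x. g x)"
      using A B t by (simp_all add: ennreal_less_iff)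
    then show "{x. ennreal (A * t) < f x} \<noteq> {}" "{x. ennreal (B * t) < g x} \<noteq> {}"
      by (auto simp: less_SUP_iff)
    fix x y assume xy: "x \<in> {x. ennreal (A * t) < f x}" "y \<in> {x. ennreal (B * t) < g x}"
    have "ennreal ((A * t) powr (1 - l) * (B * t) powr l) \<le> h ((1 - l) * x + l * y)"
      using xy A B t by (intro gm_leD[OF gm]) auto
    moreover have "(A * t) powr (1 - l) * (B * t) powr l = c * (t powr (1 - l) * t powr l)"
      using A B t by (simp add: c_def powr_mult)
    moreover have "t powr (1 - l) * t powr l = t" using t by (simp flip: powr_add)
    ultimately show "(1 - l) * x + l * y \<in> {x. ennreal (c * t) \<le> h x}" by simp
  qed (use l in auto)
  have "ennreal (a / A) < (\<integral>\<^sup>+t. indicator {0<..<1} t * F t \<partial>lborel)"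
    using ab(3) unfolding nn_integral_layer_cake_bounded[OF assms(1) A(1) fA] F_def
    by (rule ennreal_less_mult_divide[OF A(1)])
  moreover have "ennreal (b / B) < (\<integral>\<^sup>+t. indicator {0<..<1} t * G t \<partial>lborel)"
    using ab(4) unfolding nn_integral_layer_cake_bounded[OF assms(2) B(1) gB] G_def
    by (rule ennreal_less_mult_divide[OF B(1)])
  ultimately have "ennreal (1 - l) * ennreal (a / A) + ennreal l * ennreal (b / B)
     \<le> ennreal (1 - l) * (\<integral>\<^sup>+t. indicator {0<..<1} t * F t \<partial>lborel) + ennreal l * (\<integral>\<^sup>+t. indicator {0<..<1} t * G t \<partial>lborel)"
    by (intro add_mono mult_left_mono) auto
  also have "\<dots> = (\<integral>\<^sup>+t. indicator {0<..<1} t * (ennreal (1 - l) * F t + ennreal l * G t) \<partial>lborel)"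
    by (simp add: nn_integral_add nn_integral_cmult distrib_left mult.left_commute)
  also have "\<dots> \<le> (\<integral>\<^sup>+t. indicator {0<..<1} t * U t \<partial>lborel)"
    using level by (intro nn_integral_mono) (auto simp: indicator_def)
  finally have *: "ennreal ((1 - l) * (a / A) + l * (b / B)) \<le> (\<integral>\<^sup>+t. indicator {0<..<1} t * U t \<partial>lborel)"
    using l ab A B by (simp only: ennreal_mult ennreal_plus divide_nonneg_pos less_imp_le mult_nonneg_nonneg
       diff_ge_0_iff_ge)
  have "a powr (1 - l) * b powr l = c * ((a / A) powr (1 - l) * (b / B) powr l)"
    using A B ab by (simp add: c_def powr_divide)
  also have "\<dots> \<le> c * ((1 - l) * (a / A) + l * (b / B))"
    using Youngs_inequality_0[of "1 - l" l "a / A" "b / B"] l A B ab c by (intro mult_left_mono) auto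
  finally have "ennreal (a powr (1 - l) * b powr l) \<le> ennreal c * ennreal ((1 - l) * (a / A) + l * (b / B))"
    by (simp only: ennreal_mult'[OF less_imp_le[OF c], symmetric] ennreal_leI)
  also have "\<dots> \<le> ennreal c * (\<integral>\<^sup>+t. indicator {0<..<1} t * U t \<partial>lborel)"
    using * by (rule mult_left_mono) simp
  also have "\<dots> \<le> integral\<^sup>N lborel h"
    unfolding U_def by (rule nn_integral_layer_cake_ge) (use c in auto)
  finally show "ennreal (a powr (1 - l) * b powr l) \<le> integral\<^sup>N lborel h" .
qed

lemma nn_integral_SUP_min:
  fixes f :: "'a \<Rightarrow> ennreal"
  assumes [measurable]: "f \<in> borel_measurable M"
  shows "(SUP n. \<integral>\<^sup>+x. min (f x) (of_nat n) \<partial>M) = (\<integral>\<^sup>+x. f x \<partial>M)"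
proof -
  have "(SUP n. min (f x) (of_nat n)) = f x" for x
  proof (rule antisym)
    show "f x \<le> (SUP n. min (f x) (of_nat n))"
    proof (rule le_SUP_iff[THEN iffD2], intro allI impI)
      fix y assume y: "y < f x"
      then have "y < top" using less_le_trans top_greatest by blast
      then obtain n where "y < of_nat n" using ennreal_Ex_less_of_nat by auto
      with y show "\<exists>n\<in>UNIV. y < min (f x) (of_nat n)" by auto
    qed
  qed (auto intro: SUP_least)
  moreover have "(\<integral>\<^sup>+x. (SUP n. min (f x) (of_nat n)) \<partial>M) = (SUP n. \<integral>\<^sup>+x. min (f x) (of_nat n) \<partial>M)"
    by (intro nn_integral_monotone_convergence_SUP) (auto simp: incseq_def le_fun_def intro: min.coboundedI2)
  ultimately show ?thesis by simp
qed

text \<open>\<open>gm_le\<close> survives truncation of \<open>f\<close> and \<open>g\<close> from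
  above, and a number strictly below an integral is already below the integral of some truncation.
  Here the strict inequalities in \<open>gm_le\<close> pay off.\<close>

lemma prekopa_leindler_real:
  fixes f g h :: "real \<Rightarrow> ennreal"
  assumes [measurable]: "f \<in> borel_measurable borel" "g \<in> borel_measurable borel" "h \<in> borel_measurable borel"
    and l: "0 < l" "l < 1"
    and gm: "\<And>x y. gm_le l (f x) (g y) (h ((1 - l) * x + l * y))"
  shows "gm_le l (\<integral>\<^sup>+x. f x \<partial>lborel) (\<integral>\<^sup>+x. g x \<partial>lborel) (\<integral>\<^sup>+x. h x \<partial>lborel)"
proof (rule gm_leI)
  fix a b :: real assume ab: "0 < a" "0 < b" "ennreal a < integral\<^sup>N lborel f" "ennreal b < integral\<^sup>N lborel g"
  obtain n where n: "ennreal a < (\<integral>\<^sup>+x. min (f x) (of_nat n) \<partial>lborel)"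
    using ab(3) nn_integral_SUP_min[of f lborel] by (metis less_SUP_iff assms(1) measurable_lborel2)
  obtain m where m: "ennreal b < (\<integral>\<^sup>+x. min (g x) (of_nat m) \<partial>lborel)"
    using ab(4) nn_integral_SUP_min[of g lborel] by (metis less_SUP_iff assms(2) measurable_lborel2)
  have "gm_le l (\<integral>\<^sup>+x. min (f x) (of_nat n) \<partial>lborel) (\<integral>\<^sup>+x. min (g x) (of_nat m) \<partial>lborel) (\<integral>\<^sup>+x. h x \<partial>lborel)"
    by (rule prekopa_leindler_bounded[where A' = "real n" and B' = "real m"])
       (use l in \<open>auto intro!: gm_le_mono[OF gm] simp: ennreal_of_nat_eq_real_of_nat\<close>)
  from gm_leD[OF this ab(1,2) n m]
  show "ennreal (a powr (1 - l) * b powr l) \<le> integral\<^sup>N lborel h" .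
qed

section \<open>The multiplicative form on the positive orthant\<close>

text \<open>The substitution rule is applied on the intervals from \<open>- n\<close> to
  \<open>n\<close>, whose images under \<open>exp\<close> exhaust the positive half-line; monotone
  convergence does the rest.\<close>

lemma distr_exp_lborel:
  "distr (density lborel (\<lambda>t::real. ennreal (exp t))) borel exp = density lborel (indicator {0<..})"
proof (rule measure_eqI)
  fix A :: "real set" assume "A \<in> sets (distr (density lborel (\<lambda>t. ennreal (exp t))) borel exp)"
  then have A[measurable]: "A \<in> sets borel" by simp
  have "emeasure (distr (density lborel (\<lambda>t::real. ennreal (exp t))) borel exp) A
      = (\<integral>\<^sup>+t. ennreal (exp t) * indicator A (exp t) \<partial>lborel)"
    by (subst nn_integral_indicator[symmetric], simp, subst nn_integral_distr)
       (auto simp: nn_integral_density)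
  also have "\<dots> = (\<integral>\<^sup>+t. (SUP n. ennreal (exp t) * indicator A (exp t) * indicator {-real n..real n} t) \<partial>lborel)"
  proof (rule nn_integral_cong)
    fix t :: real
    obtain n where "\<bar>t\<bar> \<le> real n" using real_arch_simple by blast
    then have "ennreal (exp t) * indicator A (exp t) \<le>
       (SUP n. ennreal (exp t) * indicator A (exp t) * indicator {-real n..real n} t)"
      by (intro SUP_upper2[of n]) (auto simp: indicator_def)
    then show "ennreal (exp t) * indicator A (exp t) =
       (SUP n. ennreal (exp t) * indicator A (exp t) * indicator {-real n..real n} t)"
      by (intro antisym SUP_least) (auto simp: indicator_def)
  qed
  also have "\<dots> = (SUP n. \<integral>\<^sup>+t. ennreal (exp t) * indicator A (exp t) * indicator {-real n..real n} t \<partial>lborel)"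
    by (intro nn_integral_monotone_convergence_SUP) (auto simp: incseq_def le_fun_def indicator_def)
  also have "\<dots> = (SUP n. \<integral>\<^sup>+x. indicator A x * indicator {exp (-real n)..exp (real n)} x \<partial>lborel)"
  proof (rule SUP_cong)
    fix n
    have "(\<integral>\<^sup>+x. ennreal (indicator A x * indicator {exp (-real n)..exp (real n)} x) \<partial>lborel)
      = (\<integral>\<^sup>+t. ennreal (indicator A (exp t) * exp t * indicator {-real n..real n} t) \<partial>lborel)"
      by (rule nn_integral_substitution)
         (auto intro!: derivative_eq_intros continuous_intros simp: set_borel_measurable_def)
    then show "(\<integral>\<^sup>+t. ennreal (exp t) * indicator A (exp t) * indicator {-real n..real n} t \<partial>lborel)
      = (\<integral>\<^sup>+x. indicator A x * indicator {exp (-real n)..exp (real n)} x \<partial>lborel)"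
      by (simp add: ennreal_mult' ennreal_indicator mult.commute)
  qed simp
  also have "\<dots> = (\<integral>\<^sup>+x. (SUP n. indicator A x * indicator {exp (-real n)..exp (real n)} x) \<partial>lborel)"
    by (intro nn_integral_monotone_convergence_SUP[symmetric])
       (auto simp: incseq_def le_fun_def indicator_def intro: order_trans[of "exp (- real _)" "exp (- real _)"] order_trans[of _ "exp (real _)"])
  also have "\<dots> = (\<integral>\<^sup>+x. indicator {0<..} x * indicator A x \<partial>lborel)"
  proof (rule nn_integral_cong)
    fix x :: real
    show "(SUP n. indicator A x * indicator {exp (-real n)..exp (real n)} x) = (indicator {0<..} x * indicator A x :: ennreal)"
    proof (cases "0 < x")
      case True
      obtain n where "\<bar>ln x\<bar> \<le> real n" using real_arch_simple by blast
      then have "- real n \<le> ln x" "ln x \<le> real n" by auto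
      then have "x \<in> {exp (-real n)..exp (real n)}" using True ln_ge_iff[OF True] 
        by (metis atLeastAtMost_iff exp_le_cancel_iff exp_ln)
      then have "indicator {0<..} x * indicator A x \<le> (SUP n. indicator A x * indicator {exp (-real n)..exp (real n)} x :: ennreal)"
        by (intro SUP_upper2[of n]) (auto simp: indicator_def)
      then show ?thesis using True by (intro antisym SUP_least) (auto simp: indicator_def)
    next
      case False
      have "x \<notin> {exp (-real n)..exp (real n)}" for n
        using False by (metis atLeastAtMost_iff exp_gt_zero less_le_trans)
      then have "indicator {exp (-real n)..exp (real n)} x = (0::ennreal)" for n
        by (rule indicator_simps(2))
      then show ?thesis using False by (simp only: mult_zero_right) simp
    qed
  qed
  also have "\<dots> = emeasure (density lborel (indicator {0<..})) A"
    by (subst emeasure_density) auto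
  finally show "emeasure (distr (density lborel (\<lambda>t::real. ennreal (exp t))) borel exp) A
     = emeasure (density lborel (indicator {0<..})) A" .
qed simp

lemma nn_integral_exp_substitution:
  fixes f :: "real \<Rightarrow> ennreal"
  assumes [measurable]: "f \<in> borel_measurable borel"
  shows "(\<integral>\<^sup>+t. ennreal (exp t) * f (exp t) \<partial>lborel) = (\<integral>\<^sup>+x. indicator {0<..} x * f x \<partial>lborel)"
proof -
  have "(\<integral>\<^sup>+x. f x \<partial>distr (density lborel (\<lambda>t::real. ennreal (exp t))) borel exp)
      = (\<integral>\<^sup>+x. f x \<partial>density lborel (indicator {0<..}))"
    by (simp only: distr_exp_lborel)
  then show ?thesis by (simp add: nn_integral_distr nn_integral_density)
qed

text \<open>Under \<open>x = exp s\<close> geometric means of arguments become arithmetic means of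
  exponents. The Jacobian fits exactly: its value at the mean exponent is the geometric mean of its
  values, as \<open>gm_le_scale\<close> requires.\<close>

lemma prekopa_leindler_real_multiplicative:
  fixes f g h :: "real \<Rightarrow> ennreal"
  assumes [measurable]: "f \<in> borel_measurable borel" "g \<in> borel_measurable borel" "h \<in> borel_measurable borel"
    and l: "0 < l" "l < 1"
    and zero: "\<And>x. x \<le> 0 \<Longrightarrow> f x = 0" "\<And>x. x \<le> 0 \<Longrightarrow> g x = 0"
    and gm: "\<And>x y. 0 < x \<Longrightarrow> 0 < y \<Longrightarrow> gm_le l (f x) (g y) (h (x powr (1 - l) * y powr l))"
  shows "gm_le l (\<integral>\<^sup>+x. f x \<partial>lborel) (\<integral>\<^sup>+x. g x \<partial>lborel) (\<integral>\<^sup>+x. h x \<partial>lborel)"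
proof -
  have eq: "(\<integral>\<^sup>+x. u x \<partial>lborel) = (\<integral>\<^sup>+t. ennreal (exp t) * u (exp t) \<partial>lborel)"
    if [measurable]: "u \<in> borel_measurable borel" and "\<And>x. x \<le> 0 \<Longrightarrow> u x = 0" for u :: "real \<Rightarrow> ennreal"
    unfolding nn_integral_exp_substitution[OF that(1)]
    using that(2) by (intro nn_integral_cong) (auto simp: indicator_def)
  have "gm_le l (\<integral>\<^sup>+t. ennreal (exp t) * f (exp t) \<partial>lborel) (\<integral>\<^sup>+t. ennreal (exp t) * g (exp t) \<partial>lborel)
     (\<integral>\<^sup>+t. ennreal (exp t) * h (exp t) \<partial>lborel)"
  proof (rule prekopa_leindler_real)
    fix x y :: real
    have "gm_le l (ennreal (exp x) * f (exp x)) (ennreal (exp y) * g (exp y))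
        (ennreal (exp x powr (1 - l) * exp y powr l) * h (exp x powr (1 - l) * exp y powr l))"
      by (intro gm_le_scale gm) auto
    moreover have "exp x powr (1 - l) * exp y powr l = exp ((1 - l) * x + l * y)"
      by (simp add: powr_def exp_add)
    ultimately show "gm_le l (ennreal (exp x) * f (exp x)) (ennreal (exp y) * g (exp y))
       (ennreal (exp ((1 - l) * x + l * y)) * h (exp ((1 - l) * x + l * y)))" by simp
  qed (use l in auto)
  moreover have "(\<integral>\<^sup>+t. ennreal (exp t) * h (exp t) \<partial>lborel) \<le> (\<integral>\<^sup>+x. h x \<partial>lborel)"
    by (subst nn_integral_exp_substitution) (auto intro!: nn_integral_mono simp: indicator_def)
  ultimately show ?thesis
    using zero by (auto simp: eq[of f] eq[of g] intro: gm_le_mono)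
qed

text \<open>Fubini and induction on the coordinates: the inequality on the line, applied in the new
  coordinate, shows that the partial integrals satisfy the hypothesis in the remaining ones.\<close>

lemma prekopa_leindler_PiM:
  fixes f g h :: "('i \<Rightarrow> real) \<Rightarrow> ennreal"
  assumes "finite I"
    and f: "f \<in> borel_measurable (PiM I (\<lambda>_. lborel))" and g: "g \<in> borel_measurable (PiM I (\<lambda>_. lborel))"
    and h: "h \<in> borel_measurable (PiM I (\<lambda>_. lborel))"
    and l: "0 < l" "l < 1"
    and zero: "\<And>x i. x \<in> extensional I \<Longrightarrow> i \<in> I \<Longrightarrow> x i \<le> 0 \<Longrightarrow> f x = 0"
      "\<And>x i. x \<in> extensional I \<Longrightarrow> i \<in> I \<Longrightarrow> x i \<le> 0 \<Longrightarrow> g x = 0"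
    and gm: "\<And>x y. x \<in> extensional I \<Longrightarrow> y \<in> extensional I \<Longrightarrow> \<forall>i\<in>I. 0 < x i \<Longrightarrow> \<forall>i\<in>I. 0 < y i \<Longrightarrow>
       gm_le l (f x) (g y) (h (\<lambda>i\<in>I. x i powr (1 - l) * y i powr l))"
  shows "gm_le l (\<integral>\<^sup>+x. f x \<partial>PiM I (\<lambda>_. lborel)) (\<integral>\<^sup>+x. g x \<partial>PiM I (\<lambda>_. lborel)) (\<integral>\<^sup>+x. h x \<partial>PiM I (\<lambda>_. lborel))"
  using assms
proof (induction I arbitrary: f g h rule: finite_induct)
  case empty
  interpret product_sigma_finite "\<lambda>_::'i. lborel :: real measure" ..
  \<comment> \<open>The empty product has a single point, the constant function
    \<open>undefined\<close>, and the claim is the hypothesis there.\<close>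
  show ?case using empty.prems(8)[of "\<lambda>_. undefined" "\<lambda>_. undefined"]
    by (simp add: nn_integral_empty restrict_def)
next
  case (insert i I)
  interpret product_sigma_finite "\<lambda>_::'i. lborel :: real measure" ..
  note i = \<open>i \<notin> I\<close>
  have meas: "(\<lambda>(x, y). u (x(i := y))) \<in> borel_measurable (PiM I (\<lambda>_. lborel) \<Otimes>\<^sub>M lborel)"
    if "u \<in> borel_measurable (PiM (insert i I) (\<lambda>_. lborel))" for u :: "('i \<Rightarrow> real) \<Rightarrow> ennreal"
    using measurable_compose[OF measurable_add_dim that] by (simp add: split_def)
  have meas1: "(\<lambda>y. u (x(i := y))) \<in> borel_measurable borel"
    if u: "u \<in> borel_measurable (PiM (insert i I) (\<lambda>_. lborel))" and x: "x \<in> extensional I"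
    for u :: "('i \<Rightarrow> real) \<Rightarrow> ennreal" and x
  proof -
    have "x \<in> space (PiM I (\<lambda>_. lborel))" using x by (simp add: space_PiM PiE_def)
    from measurable_compose[OF measurable_Pair1'[OF this] meas[OF u]] show ?thesis by simp
  qed
  have meas2: "(\<lambda>x. \<integral>\<^sup>+y. u (x(i := y)) \<partial>lborel) \<in> borel_measurable (PiM I (\<lambda>_. lborel))"
    if u: "u \<in> borel_measurable (PiM (insert i I) (\<lambda>_. lborel))" for u :: "('i \<Rightarrow> real) \<Rightarrow> ennreal"
    using lborel.borel_measurable_nn_integral[OF meas[OF u]] .
  have ext: "x(i := y) \<in> extensional (insert i I)" if "x \<in> extensional I" for x :: "'i \<Rightarrow> real" and y
    using that by (auto simp: extensional_def)
  have vanish: "(\<integral>\<^sup>+y. u (x(i := y)) \<partial>lborel) = 0"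
    if "\<And>x j. x \<in> extensional (insert i I) \<Longrightarrow> j \<in> insert i I \<Longrightarrow> x j \<le> 0 \<Longrightarrow> u x = 0"
      and "x \<in> extensional I" "j \<in> I" "x j \<le> 0" for u :: "('i \<Rightarrow> real) \<Rightarrow> ennreal" and x j
  proof -
    have "u (x(i := y)) = 0" for y
      using that(1)[OF ext[OF that(2)], of j y] that(3,4) i by (cases "j = i") auto
    then show ?thesis by simp
  qed
  show ?case
    unfolding product_nn_integral_insert[OF insert(1,2) insert.prems(1)]
      product_nn_integral_insert[OF insert(1,2) insert.prems(2)]
      product_nn_integral_insert[OF insert(1,2) insert.prems(3)]
  proof (rule insert.IH)
    fix x y :: "'i \<Rightarrow> real"
    assume x: "x \<in> extensional I" "\<forall>i\<in>I. 0 < x i" and y: "y \<in> extensional I" "\<forall>i\<in>I. 0 < y i"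
    let ?z = "\<lambda>i\<in>I. x i powr (1 - l) * y i powr l"
    show "gm_le l (\<integral>\<^sup>+s. f (x(i := s)) \<partial>lborel) (\<integral>\<^sup>+t. g (y(i := t)) \<partial>lborel) (\<integral>\<^sup>+r. h (?z(i := r)) \<partial>lborel)"
    proof (rule prekopa_leindler_real_multiplicative)
      show "(\<lambda>s. f (x(i := s))) \<in> borel_measurable borel" by (rule meas1[OF insert.prems(1) x(1)])
      show "(\<lambda>s. g (y(i := s))) \<in> borel_measurable borel" by (rule meas1[OF insert.prems(2) y(1)])
      show "(\<lambda>s. h (?z(i := s))) \<in> borel_measurable borel" by (rule meas1[OF insert.prems(3)]) simp
      fix s t :: real
      show "f (x(i := s)) = 0" if "s \<le> 0"
        using that by (intro insert.prems(6)[OF ext[OF x(1)], of i]) auto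
      show "g (y(i := s)) = 0" if "s \<le> 0"
        using that by (intro insert.prems(7)[OF ext[OF y(1)], of i]) auto
      assume st: "0 < s" "0 < t"
      have "gm_le l (f (x(i := s))) (g (y(i := t)))
        (h (\<lambda>j\<in>insert i I. (x(i := s)) j powr (1 - l) * (y(i := t)) j powr l))"
        using x(2) y(2) st by (intro insert.prems(8) ext x y) auto
      moreover have "(\<lambda>j\<in>insert i I. (x(i := s)) j powr (1 - l) * (y(i := t)) j powr l)
          = ?z(i := s powr (1 - l) * t powr l)"
        using i by (auto simp: fun_eq_iff)
      ultimately show "gm_le l (f (x(i := s))) (g (y(i := t))) (h (?z(i := s powr (1 - l) * t powr l)))"
        by simp
    qed (use l in auto)
  next
    fix x j assume "x \<in> extensional I" "j \<in> I" "x j \<le> (0::real)"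
    then show "(\<integral>\<^sup>+y. f (x(i := y)) \<partial>lborel) = 0" "(\<integral>\<^sup>+y. g (x(i := y)) \<partial>lborel) = 0"
      using vanish[of f x j] vanish[of g x j] insert.prems(6,7) by blast+
  qed (rule meas2 insert.prems l)+
qed

section \<open>Finite reflection systems\<close>

text \<open>This is the orthogonal reflection only for unit \<open>u\<close>. Being polynomial, the
  formula is continuous in \<open>u\<close>, which later makes the set of symmetry normals
  closed.\<close>

definition reflect :: "'a::real_inner \<Rightarrow> 'a \<Rightarrow> 'a" where
  "reflect u x = x - (2 * (u \<bullet> x)) *\<^sub>R u"

lemma linear_reflect: "linear (reflect u)"
  by (rule linearI) (simp_all add: reflect_def inner_simps algebra_simps)

lemma inner_reflect_left: "reflect u x \<bullet> y = x \<bullet> reflect u y"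
  by (simp add: reflect_def inner_simps inner_commute)

lemma reflect_reflect: "norm u = 1 \<Longrightarrow> reflect u (reflect u x) = x"
  by (simp add: reflect_def inner_simps algebra_simps norm_eq_1 flip: scaleR_add_left)

lemma inner_reflect_reflect: "norm u = 1 \<Longrightarrow> reflect u x \<bullet> reflect u y = x \<bullet> y"
  by (simp add: inner_reflect_left reflect_reflect)

lemma norm_reflect: "norm u = 1 \<Longrightarrow> norm (reflect u x) = norm x"
  by (simp add: norm_eq_sqrt_inner inner_reflect_reflect)

lemma reflect_self: "norm u = 1 \<Longrightarrow> reflect u u = - u"
  by (simp add: reflect_def norm_eq_1 scaleR_2)

lemma reflect_orthogonal: "u \<bullet> x = 0 \<Longrightarrow> reflect u x = x"
  by (simp add: reflect_def)

lemma reflect_uminus: "reflect (- u) x = reflect u x"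
  by (simp add: reflect_def)

text \<open>The source of stability: if two reflections preserve a set, so does the conjugate of one
  by the other.\<close>

lemma reflect_conjugate: "norm u = 1 \<Longrightarrow> reflect (reflect u v) x = reflect u (reflect v (reflect u x))"
  by (simp add: reflect_def inner_simps algebra_simps norm_eq_1 inner_commute)

lemma orthogonal_transformation_reflect: "norm u = 1 \<Longrightarrow> orthogonal_transformation (reflect u)"
  by (simp add: orthogonal_transformation_def linear_reflect inner_reflect_reflect)

text \<open>A root system with unit roots, without integrality, finiteness or spanning: it has to
  cover the possibly infinite set of all symmetries and the lower-dimensional systems met in the
  descent.\<close>

definition refl_closed :: "'a::euclidean_space set \<Rightarrow> bool" where
  "refl_closed R \<longleftrightarrow> (\<forall>u\<in>R. norm u = 1) \<and> (\<forall>u\<in>R. \<forall>v\<in>R. reflect u v \<in> R)"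

lemma refl_closedD: "refl_closed R \<Longrightarrow> u \<in> R \<Longrightarrow> norm u = 1"
  "refl_closed R \<Longrightarrow> u \<in> R \<Longrightarrow> v \<in> R \<Longrightarrow> reflect u v \<in> R"
  by (auto simp: refl_closed_def)

lemma refl_closed_uminus: "refl_closed R \<Longrightarrow> u \<in> R \<Longrightarrow> - u \<in> R"
  using refl_closedD[of R u] by (metis reflect_self)

text \<open>Reflecting the root at angle \<open>m * t\<close> in the one at angle
  \<open>(m + 1) * t\<close> and reversing the sign gives the root at angle
  \<open>(m + 2) * t\<close>. The induction therefore carries two consecutive roots.\<close>

lemma refl_closed_rotation:
  assumes R: "refl_closed R" and u: "u \<in> R" and e: "norm e = 1" "u \<bullet> e = 0"
    and v: "cos t *\<^sub>R u + sin t *\<^sub>R e \<in> R"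
  shows "cos (real m * t) *\<^sub>R u + sin (real m * t) *\<^sub>R e \<in> R"
proof -
  let ?w = "\<lambda>m::nat. cos (real m * t) *\<^sub>R u + sin (real m * t) *\<^sub>R e"
  have nu: "u \<bullet> u = 1" "e \<bullet> e = 1" "e \<bullet> u = 0"
    using refl_closedD(1)[OF R u] e by (simp_all add: norm_eq_1 inner_commute)
  have "?w m \<in> R \<and> ?w (Suc m) \<in> R"
  proof (induction m)
    case 0 then show ?case using u v by simp
  next
    case (Suc m)
    have ip: "?w (Suc m) \<bullet> ?w m = cos t"
    proof -
      have "?w (Suc m) \<bullet> ?w m = cos (real (Suc m) * t) * cos (real m * t) + sin (real (Suc m) * t) * sin (real m * t)"
        using nu e by (simp add: inner_simps)
      also have "\<dots> = cos (real (Suc m) * t - real m * t)" by (simp only: cos_diff)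
      also have "real (Suc m) * t - real m * t = t" by (simp add: algebra_simps)
      finally show ?thesis .
    qed
    have s: "real (Suc (Suc m)) * t = real (Suc m) * t + t" "real m * t = real (Suc m) * t - t"
      by (simp_all add: algebra_simps)
    have c: "cos (real (Suc (Suc m)) * t) = 2 * cos t * cos (real (Suc m) * t) - cos (real m * t)"
      "sin (real (Suc (Suc m)) * t) = 2 * cos t * sin (real (Suc m) * t) - sin (real m * t)"
      unfolding s by (simp_all only: cos_add cos_diff sin_add sin_diff) (simp_all add: algebra_simps)
    have "?w (Suc (Suc m)) = - reflect (?w (Suc m)) (?w m)"
      unfolding reflect_def ip c by (simp add: algebra_simps)
    moreover have "- reflect (?w (Suc m)) (?w m) \<in> R"
      using Suc by (intro refl_closed_uminus refl_closedD(2)) (use R in auto)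
    ultimately show ?case using Suc by simp
  qed
  then show ?thesis by simp
qed

text \<open>An accumulation point provides pairs of roots at arbitrarily small angles. The multiples
  of such an angle form a fine net on the circle through the pair, and along a subsequence these
  circles converge to one that lies in the closed set \<open>R\<close>.\<close>

lemma refl_closed_infinite_circle:
  fixes R :: "'a::euclidean_space set"
  assumes R: "refl_closed R" and cl: "closed R" and inf: "infinite R"
  shows "\<exists>u e. norm u = 1 \<and> norm e = 1 \<and> u \<bullet> e = 0 \<and> (\<forall>t\<ge>0. cos t *\<^sub>R u + sin t *\<^sub>R e \<in> R)"
proof -
  have bR: "bounded R" using refl_closedD(1)[OF R] by (auto simp: bounded_iff)
  obtain a :: "nat \<Rightarrow> 'a" where a: "inj a" "range a \<subseteq> R" using inf infinite_countable_subset by blast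
  then obtain x r where xr: "x \<in> R" "strict_mono r" "(a \<circ> r) \<longlonglongrightarrow> x"
    using compact_eq_bounded_closed[of R] bR cl unfolding compact_def by blast
  define b where "b = a \<circ> r"
  have injb: "inj b" unfolding b_def using a(1) strict_mono_imp_inj_on[OF xr(2)] by (simp add: inj_compose)
  have bR': "b n \<in> R" for n using a by (auto simp: b_def)
  have blim: "b \<longlonglongrightarrow> x" using xr by (simp add: b_def)
  have nb: "b n \<bullet> b n = 1" for n using refl_closedD(1)[OF R bR'] by (simp add: norm_eq_1)
  have nx: "x \<bullet> x = 1" using refl_closedD(1)[OF R xr(1)] by (simp add: norm_eq_1)
  define c where "c = (\<lambda>n. b n \<bullet> b (Suc n))"
  have clim: "c \<longlonglongrightarrow> 1"
    using tendsto_inner[OF blim LIMSEQ_Suc[OF blim]] nx by (simp add: c_def)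
  have c_lt: "c n < 1" for n
  proof -
    have "b n \<noteq> b (Suc n)" using injb by (metis injD n_not_Suc_n)
    then have "0 < (b n - b (Suc n)) \<bullet> (b n - b (Suc n))" by simp
    also have "\<dots> = 2 - 2 * c n" using nb by (simp add: inner_diff_left inner_diff_right c_def inner_commute)
    finally show ?thesis by simp
  qed
  \<comment> \<open>Positive cosines keep the angles \<open>th n\<close> strictly between 0 and
    \<open>pi / 2\<close>, so that the sines used as divisors are positive.\<close>
  obtain N where N: "\<And>n. n \<ge> N \<Longrightarrow> 0 < c n"
    using order_tendstoD(1)[OF clim, of 0] by (auto simp: eventually_sequentially)
  define th where "th = (\<lambda>n. arccos (c (n + N)))"
  have cN: "0 < c (n + N)" "c (n + N) < 1" for n using N c_lt by auto
  have cos_th: "cos (th n) = c (n + N)" for n using cN[of n] by (simp add: th_def)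
  have th_pos: "0 < th n" "th n < pi / 2" for n using cN[of n] arccos_lt_bounded[of "c (n+N)"] arccos_less_arccos[of 0 "c (n+N)"]
    by (auto simp: th_def)
  have sin_pos: "0 < sin (th n)" for n using th_pos[of n] by (intro sin_gt_zero) auto
  have th_lim: "th \<longlonglongrightarrow> 0"
  proof -
    have "(\<lambda>n. arccos (c (n + N))) \<longlonglongrightarrow> arccos 1"
      using cN by (intro continuous_on_tendsto_compose[OF continuous_on_arccos' LIMSEQ_ignore_initial_segment[OF clim]])
        (auto intro!: eventuallyI less_imp_le intro: less_trans[of _ 0])
    then show ?thesis by (simp add: th_def)
  qed
  define u where "u = (\<lambda>n. b (n + N))"
  \<comment> \<open>The unit vector orthogonal to \<open>u n\<close> for which the next root lies at
    angle \<open>th n\<close>.\<close>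
  define e where "e = (\<lambda>n. (1 / sin (th n)) *\<^sub>R (b (Suc n + N) - cos (th n) *\<^sub>R u n))"
  have ulim: "u \<longlonglongrightarrow> x" unfolding u_def by (rule LIMSEQ_ignore_initial_segment[OF blim])
  have uR: "u n \<in> R" for n using bR' by (simp add: u_def)
  have v: "cos (th n) *\<^sub>R u n + sin (th n) *\<^sub>R e n = b (Suc n + N)" for n
    using sin_pos[of n] by (simp add: e_def)
  have ue: "u n \<bullet> e n = 0" for n
    using nb[of "n+N"] cos_th[of n] by (simp add: e_def u_def inner_simps c_def)
  have ne: "norm (e n) = 1" for n
  proof -
    have "e n \<bullet> e n = (1 / (sin (th n))\<^sup>2) * (1 - (cos (th n))\<^sup>2)"
      using nb[of "n+N"] nb[of "Suc n + N"] cos_th[of n]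
      by (simp add: e_def u_def inner_simps c_def power2_eq_square inner_commute)
    also have "\<dots> = 1" using sin_pos[of n] by (simp add: sin_squared_eq[symmetric])
    finally show ?thesis by (simp add: norm_eq_1)
  qed
  \<comment> \<open>The planes vary with \<open>n\<close>; a further subsequence makes their second
    axes converge too.\<close>
  have "compact (sphere (0::'a) 1)" by simp
  then obtain e' s where e': "e' \<in> sphere 0 1" "strict_mono s" "(e \<circ> s) \<longlonglongrightarrow> e'"
    using ne unfolding compact_def by (metis mem_sphere_0)
  have us: "(\<lambda>n. u (s n)) \<longlonglongrightarrow> x" using LIMSEQ_subseq_LIMSEQ[OF ulim e'(2)] by (simp add: o_def)
  have es: "(\<lambda>n. e (s n)) \<longlonglongrightarrow> e'" using e'(3) by (simp add: o_def)
  have ts: "(\<lambda>n. th (s n)) \<longlonglongrightarrow> 0" using LIMSEQ_subseq_LIMSEQ[OF th_lim e'(2)] by (simp add: o_def)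
  have "x \<bullet> e' = 0"
    using LIMSEQ_unique[OF tendsto_inner[OF us es]] ue by simp
  moreover have "cos t *\<^sub>R x + sin t *\<^sub>R e' \<in> R" if t: "0 \<le> t" for t
  proof -
    \<comment> \<open>This picks the largest multiple of \<open>th (s n)\<close> not exceeding
      \<open>t\<close>, hence one within \<open>th (s n)\<close> of it.\<close>
    define m where "m = (\<lambda>n. nat \<lfloor>t / th (s n)\<rfloor>)"
    define q where "q = (\<lambda>n. real (m n) * th (s n))"
    have q: "\<bar>q n - t\<bar> \<le> th (s n)" for n
    proof -
      have p: "0 < th (s n)" by (rule th_pos)
      have "real (m n) = of_int \<lfloor>t / th (s n)\<rfloor>" using t p by (simp add: m_def)
      then have "real (m n) \<le> t / th (s n)" "t / th (s n) < real (m n) + 1" by linarith+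
      then have "q n \<le> t" "t < q n + th (s n)" using p by (simp_all add: q_def field_simps)
      then show ?thesis by linarith
    qed
    have "(\<lambda>n. q n - t) \<longlonglongrightarrow> 0"
      by (rule Lim_null_comparison[OF _ ts]) (use q in auto)
    then have qlim: "q \<longlonglongrightarrow> t" by (simp add: LIM_zero_iff)
    have "cos (q n) *\<^sub>R u (s n) + sin (q n) *\<^sub>R e (s n) \<in> R" for n
      unfolding q_def
      using uR ue ne v bR' by (intro refl_closed_rotation[OF R]) auto
    moreover have "(\<lambda>n. cos (q n) *\<^sub>R u (s n) + sin (q n) *\<^sub>R e (s n)) \<longlonglongrightarrow> cos t *\<^sub>R x + sin t *\<^sub>R e'"
      by (intro tendsto_intros qlim us es)
    ultimately show ?thesis by (rule closed_sequentially[OF cl])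
  qed
  moreover have "norm x = 1" "norm e' = 1" using nx e'(1) by (auto simp: norm_eq_1)
  ultimately show ?thesis by blast
qed

text \<open>A root in the plane of the circle reflects the component \<open>p\<close> of
  \<open>v\<close> in that plane onto a multiple of \<open>e\<close> of the same length
  \<open>s\<close>. The resulting root is orthogonal to \<open>u\<close> and differs from the
  projection of \<open>v\<close> by a multiple of the root \<open>e\<close>.\<close>

lemma refl_closed_orthogonal_span:
  assumes R: "refl_closed R" and u: "norm u = 1" and e: "norm e = 1" "u \<bullet> e = 0"
    and circ: "\<And>t. 0 \<le> t \<Longrightarrow> cos t *\<^sub>R u + sin t *\<^sub>R e \<in> R" and v: "v \<in> R"
  shows "v - (u \<bullet> v) *\<^sub>R u \<in> span (R \<inter> {x. u \<bullet> x = 0})"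
proof -
  have nu: "u \<bullet> u = 1" "e \<bullet> e = 1" "e \<bullet> u = 0"
    using u e by (simp_all add: norm_eq_1 inner_commute)
  have circ': "a *\<^sub>R u + b *\<^sub>R e \<in> R" if "a\<^sup>2 + b\<^sup>2 = 1" for a b
    using sincos_total_2pi[OF that] circ by metis
  have eR: "e \<in> R" using circ'[of 0 1] by simp
  define p where "p = (u \<bullet> v) *\<^sub>R u + (e \<bullet> v) *\<^sub>R e"
  define s where "s = sqrt ((u \<bullet> v)\<^sup>2 + (e \<bullet> v)\<^sup>2)"
  have s2: "s\<^sup>2 = (u \<bullet> v)\<^sup>2 + (e \<bullet> v)\<^sup>2" by (simp add: s_def)
  have "v - p + s *\<^sub>R e \<in> R"
  proof (cases "u \<bullet> v = 0 \<and> e \<bullet> v = s")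
    case True then show ?thesis using v by (simp add: p_def)
  next
    case False
    define d where "d = sqrt ((u \<bullet> v)\<^sup>2 + (e \<bullet> v - s)\<^sup>2)"
    have d2: "d\<^sup>2 = (u \<bullet> v)\<^sup>2 + (e \<bullet> v - s)\<^sup>2" by (simp add: d_def)
    have "(u \<bullet> v)\<^sup>2 + (e \<bullet> v - s)\<^sup>2 \<noteq> 0" using False by (simp add: sum_power2_eq_zero_iff)
    then have d: "d \<noteq> 0" using d2 by auto
    \<comment> \<open>The normalised difference of \<open>p\<close> and its target
      \<open>s *\<^sub>R e\<close>; the case in which they coincide has been split off.\<close>
    define w where "w = ((u \<bullet> v) / d) *\<^sub>R u + ((e \<bullet> v - s) / d) *\<^sub>R e"
    have "((u \<bullet> v) / d)\<^sup>2 + ((e \<bullet> v - s) / d)\<^sup>2 = 1"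
      using d by (simp add: power_divide d2[symmetric] flip: add_divide_distrib)
    then have "w \<in> R" unfolding w_def by (rule circ')
    then have "reflect w v \<in> R" using R v refl_closedD by blast
    moreover have "reflect w v = v - p + s *\<^sub>R e"
    proof -
      have "2 * (w \<bullet> v) * d = 2 * ((u \<bullet> v)\<^sup>2 + (e \<bullet> v - s) * (e \<bullet> v))"
        using d by (simp add: w_def inner_simps field_simps power2_eq_square)
      also have "\<dots> = d\<^sup>2" unfolding d2 using s2 by (simp add: power2_eq_square algebra_simps)
      finally have "2 * (w \<bullet> v) = d" using d by (simp add: power2_eq_square)
      then have "reflect w v = v - d *\<^sub>R w" by (simp add: reflect_def)
      also have "\<dots> = v - p + s *\<^sub>R e"
        using d by (simp add: w_def p_def scaleR_add_right scaleR_diff_left)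
      finally show ?thesis .
    qed
    ultimately show ?thesis by simp
  qed
  moreover have "u \<bullet> (v - p + s *\<^sub>R e) = 0" using nu e by (simp add: p_def inner_simps)
  ultimately have 1: "v - p + s *\<^sub>R e \<in> span (R \<inter> {x. u \<bullet> x = 0})" by (intro span_base) auto
  have 2: "e \<in> span (R \<inter> {x. u \<bullet> x = 0})" using eR e by (intro span_base) auto
  have "v - (u \<bullet> v) *\<^sub>R u = (v - p + s *\<^sub>R e) + ((e \<bullet> v) - s) *\<^sub>R e"
    by (simp add: p_def algebra_simps)
  then show ?thesis using 1 2 by (metis span_add span_scale)
qed

text \<open>If \<open>R\<close> is infinite, it contains a circle, and then \<open>R\<close> can be replaced by a root \<open>u\<close> of
  this circle and the roots orthogonal to \<open>u\<close> without making the span smaller.\<close>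

lemma refl_closed_finite_subsystem:
  fixes R :: "'a::euclidean_space set"
  assumes "refl_closed R" "closed R"
  shows "\<exists>R0\<subseteq>R. finite R0 \<and> refl_closed R0 \<and> R \<subseteq> span R0"
  using assms
proof (induction "dim R" arbitrary: R rule: less_induct)
  case less
  show ?case
  proof (cases "finite R")
    case True
    then show ?thesis using less.prems by (intro exI[of _ R]) (auto intro: span_base)
  next
    case False
    then obtain u e where ue: "norm u = 1" "norm e = 1" "u \<bullet> e = 0"
      and circ: "\<And>t. 0 \<le> t \<Longrightarrow> cos t *\<^sub>R u + sin t *\<^sub>R e \<in> R"
      using refl_closed_infinite_circle less.prems by blast
    have uR: "u \<in> R" using circ[of 0] by simp
    define R' where "R' = R \<inter> {x. u \<bullet> x = 0}"
    have "span R' \<subseteq> {x. u \<bullet> x = 0}"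
      by (rule span_minimal) (auto simp: R'_def subspace_hyperplane)
    then have "u \<notin> span R'" using ue by (auto simp: norm_eq_1)
    then have "R' \<subseteq> R" "span R' \<noteq> span R" using span_base[OF uR] by (auto simp: R'_def)
    then have "dim R' < dim R" by (intro dim_psubset) (auto dest: span_mono)
    moreover have "refl_closed R'"
      using less.prems(1) unfolding R'_def refl_closed_def
      by (auto simp: reflect_def inner_simps)
    moreover have "closed R'"
      unfolding R'_def by (intro closed_Int less.prems closed_hyperplane)
    ultimately obtain S where S: "S \<subseteq> R'" "finite S" "refl_closed S" "R' \<subseteq> span S"
      using less.hyps by blast
    \<comment> \<open>As \<open>S\<close> is orthogonal to \<open>u\<close>, reflections in one part
      fix the other; \<open>- u\<close> is the image of \<open>u\<close> under its own
      reflection.\<close>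
    define R0 where "R0 = {u, -u} \<union> S"
    have orth: "u \<bullet> x = 0" if "x \<in> S" for x using S(1) that by (auto simp: R'_def)
    have "refl_closed R0"
      unfolding refl_closed_def R0_def
      using S(3) ue(1) orth
      by (auto simp: refl_closed_def reflect_uminus reflect_self reflect_orthogonal inner_commute linear_neg[OF linear_reflect])
    moreover have "R0 \<subseteq> R" using uR S(1) refl_closed_uminus[OF less.prems(1)] by (auto simp: R0_def R'_def)
    moreover have "R \<subseteq> span R0"
    proof
      fix v assume v: "v \<in> R"
      have "v - (u \<bullet> v) *\<^sub>R u \<in> span R'"
        unfolding R'_def by (rule refl_closed_orthogonal_span[OF less.prems(1) ue(1,2,3) circ v])
      also have "span R' \<subseteq> span S" using S(4) by (simp add: span_minimal)
      also have "span S \<subseteq> span R0" by (intro span_mono) (auto simp: R0_def)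
      finally have "v - (u \<bullet> v) *\<^sub>R u \<in> span R0" .
      moreover have "(u \<bullet> v) *\<^sub>R u \<in> span R0" by (intro span_scale span_base) (simp add: R0_def)
      ultimately show "v \<in> span R0" using span_add by fastforce
    qed
    moreover have "finite R0" using S(2) by (simp add: R0_def)
    ultimately show ?thesis by blast
  qed
qed

section \<open>Simple systems and coordinates on a chamber\<close>

definition nonneg_span :: "'a::real_vector set \<Rightarrow> 'a set" where
  "nonneg_span D = {x. \<exists>k. (\<forall>a\<in>D. 0 \<le> k a) \<and> x = (\<Sum>a\<in>D. k a *\<^sub>R a)}"

lemma nonneg_span_add: "x \<in> nonneg_span D \<Longrightarrow> y \<in> nonneg_span D \<Longrightarrow> x + y \<in> nonneg_span D"
proof -
  assume "x \<in> nonneg_span D" "y \<in> nonneg_span D"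
  then obtain k l where "\<forall>a\<in>D. 0 \<le> k a" "x = (\<Sum>a\<in>D. k a *\<^sub>R a)" "\<forall>a\<in>D. 0 \<le> l a" "y = (\<Sum>a\<in>D. l a *\<^sub>R a)"
    unfolding nonneg_span_def by blast
  then show ?thesis unfolding nonneg_span_def
    by (intro CollectI exI[of _ "\<lambda>a. k a + l a"]) (simp add: scaleR_add_left sum.distrib)
qed

lemma nonneg_span_scale: "x \<in> nonneg_span D \<Longrightarrow> 0 \<le> c \<Longrightarrow> c *\<^sub>R x \<in> nonneg_span D"
proof -
  assume "x \<in> nonneg_span D" "0 \<le> c"
  then obtain k where "\<forall>a\<in>D. 0 \<le> k a" "x = (\<Sum>a\<in>D. k a *\<^sub>R a)"
    unfolding nonneg_span_def by blast
  with \<open>0 \<le> c\<close> show ?thesis unfolding nonneg_span_def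
    by (intro CollectI exI[of _ "\<lambda>a. c * k a"]) (simp add: scaleR_sum_right)
qed

lemma nonneg_span_base: "finite D \<Longrightarrow> a \<in> D \<Longrightarrow> a \<in> nonneg_span D"
  unfolding nonneg_span_def
  by (intro CollectI exI[of _ "\<lambda>b. if b = a then 1 else 0"]) (simp add: if_distrib[of "\<lambda>c. c *\<^sub>R _"] cong: if_cong)

lemma nonneg_span_zero: "0 \<in> nonneg_span D"
  unfolding nonneg_span_def by (intro CollectI exI[of _ "\<lambda>_. 0"]) simp

lemma nonneg_span_sum: "(\<And>i. i \<in> I \<Longrightarrow> f i \<in> nonneg_span D) \<Longrightarrow> sum f I \<in> nonneg_span D"
  by (induction I rule: infinite_finite_induct) (auto intro: nonneg_span_add nonneg_span_zero)

lemma nonneg_span_minimal: "D \<subseteq> nonneg_span E \<Longrightarrow> nonneg_span D \<subseteq> nonneg_span E"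
  by (auto simp: nonneg_span_def[of D] intro!: nonneg_span_sum nonneg_span_scale)

lemma nonneg_span_decompose:
  assumes "finite D" "b \<in> D" "x \<in> nonneg_span D"
  obtains k y where "0 \<le> k" "y \<in> nonneg_span (D - {b})" "x = k *\<^sub>R b + y"
proof -
  obtain k where k: "\<forall>a\<in>D. 0 \<le> k a" "x = (\<Sum>a\<in>D. k a *\<^sub>R a)"
    using assms(3) unfolding nonneg_span_def by blast
  have "x = k b *\<^sub>R b + (\<Sum>a\<in>D - {b}. k a *\<^sub>R a)"
    using k(2) assms by (simp add: sum.remove)
  moreover have "(\<Sum>a\<in>D - {b}. k a *\<^sub>R a) \<in> nonneg_span (D - {b})"
    using k(1) unfolding nonneg_span_def by blast
  ultimately show ?thesis using that k(1) assms(2) by blast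
qed

lemma nonneg_span_inner:
  assumes "x \<in> nonneg_span D" "\<And>a. a \<in> D \<Longrightarrow> 0 \<le> p \<bullet> a"
  shows "0 \<le> p \<bullet> x"
  using assms unfolding nonneg_span_def by (auto simp: inner_sum_right intro!: sum_nonneg)

text \<open>Collecting \<open>b\<close> on one side leaves \<open>c *\<^sub>R a + y\<close> on the
  other, which has positive product with \<open>p\<close>. So the coefficient \<open>s - k\<close>
  of \<open>b\<close> is positive and can be divided out. A minimal generating set excludes such a
  relation.\<close>

lemma nonneg_span_absorb:
  assumes D: "finite D" and pos: "\<And>a. a \<in> D \<Longrightarrow> 0 < p \<bullet> a"
    and a: "a \<in> D" and b: "b \<in> D" "a \<noteq> b" and c: "0 < c"
    and mem: "s *\<^sub>R b - c *\<^sub>R a \<in> nonneg_span D"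
  shows "b \<in> nonneg_span (D - {b})"
proof -
  obtain k y where k: "0 \<le> k" "y \<in> nonneg_span (D - {b})" "s *\<^sub>R b - c *\<^sub>R a = k *\<^sub>R b + y"
    using nonneg_span_decompose[OF D b(1) mem] by blast
  define w where "w = c *\<^sub>R a + y"
  have w: "(s - k) *\<^sub>R b = w" using k(3) by (simp add: w_def algebra_simps)
  have "w \<in> nonneg_span (D - {b})"
    unfolding w_def using D a b c by (intro nonneg_span_add nonneg_span_scale nonneg_span_base k(2)) auto
  moreover have "0 \<le> p \<bullet> y" using k(2) pos by (intro nonneg_span_inner[of y "D - {b}"]) (auto simp: less_imp_le)
  then have "0 < p \<bullet> w" using pos[OF a] c by (simp add: w_def inner_simps add_pos_nonneg)
  then have "0 < (s - k) * (p \<bullet> b)" by (simp flip: w)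
  then have sk: "0 < s - k" using pos[OF b(1)] by (simp add: zero_less_mult_iff)
  then have "b = (1 / (s - k)) *\<^sub>R w" by (simp flip: w)
  ultimately show ?thesis using sk by (metis nonneg_span_scale less_imp_le zero_less_divide_1_iff)
qed

text \<open>What is kept of the simple roots of a root system: an open half-space and pairwise
  non-acute angles. This already forces independence, and within the span it places the dual cone
  inside the cone generated by \<open>D\<close>.\<close>

locale obtuse_system =
  fixes p :: "'a::euclidean_space" and D :: "'a set"
  assumes finite_D: "finite D"
    and pos: "a \<in> D \<Longrightarrow> 0 < p \<bullet> a"
    and obtuse: "a \<in> D \<Longrightarrow> b \<in> D \<Longrightarrow> a \<noteq> b \<Longrightarrow> a \<bullet> b \<le> 0"
begin

text \<open>Coefficients of different sign belong to distinct vectors, so \<open>obtuse\<close>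
  applies to every mixed term.\<close>

lemma parts_inner_nonneg:
  "0 \<le> (\<Sum>a | a \<in> D \<and> 0 \<le> c a. c a *\<^sub>R a) \<bullet> (\<Sum>a | a \<in> D \<and> c a < 0. c a *\<^sub>R a)"
proof -
  have "0 \<le> c b * (c a * (a \<bullet> b))" if "a \<in> D" "0 \<le> c a" "b \<in> D" "c b < 0" for a b
  proof -
    have "a \<bullet> b \<le> 0" using that by (intro obtuse) auto
    then have "c a * (a \<bullet> b) \<le> 0" using that by (simp add: mult_nonneg_nonpos)
    then show ?thesis using that by (simp add: mult_nonpos_nonpos)
  qed
  then show ?thesis
    by (auto simp: inner_sum_left inner_sum_right sum_distrib_left intro!: sum_nonneg)
qed

lemma sum_parts:
  "(\<Sum>a\<in>D. c a *\<^sub>R a) = (\<Sum>a | a \<in> D \<and> 0 \<le> c a. c a *\<^sub>R a) + (\<Sum>a | a \<in> D \<and> c a < 0. c a *\<^sub>R a)"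
proof -
  have "D = {a. a \<in> D \<and> 0 \<le> c a} \<union> {a. a \<in> D \<and> c a < 0}" by auto
  then show ?thesis
    using finite_D by (subst (1) \<open>D = _\<close>, subst sum.union_disjoint) auto
qed

text \<open>With \<open>n\<close> the negative part of \<open>x\<close>, the hypothesis gives
  \<open>x \<bullet> n \<le> 0\<close>, while the mixed terms give
  \<open>n \<bullet> n \<le> x \<bullet> n\<close>. Hence \<open>n = 0\<close>; but a negative
  coefficient would make \<open>p \<bullet> n\<close> negative.\<close>

lemma coeff_nonneg:
  assumes x: "x = (\<Sum>a\<in>D. c a *\<^sub>R a)" and nonneg: "\<And>a. a \<in> D \<Longrightarrow> 0 \<le> a \<bullet> x" and a: "a \<in> D"
  shows "0 \<le> c a"
proof (rule ccontr)
  assume neg: "\<not> 0 \<le> c a"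
  define n where "n = (\<Sum>a | a \<in> D \<and> c a < 0. c a *\<^sub>R a)"
  have "x \<bullet> n = (\<Sum>a | a \<in> D \<and> c a < 0. c a * (a \<bullet> x))"
    by (simp add: n_def inner_sum_right inner_commute)
  also have "\<dots> \<le> 0" using nonneg by (intro sum_nonpos) (auto simp: mult_nonpos_nonneg)
  finally have "x \<bullet> n \<le> 0" .
  moreover have "n \<bullet> n \<le> x \<bullet> n"
    using parts_inner_nonneg[of c] unfolding x sum_parts[of c] n_def[symmetric] by (simp add: inner_simps)
  ultimately have "n \<bullet> n \<le> 0" by linarith
  then have "n = 0" using inner_gt_zero_iff[of n] by linarith
  then have "p \<bullet> n = 0" by simp
  moreover have "p \<bullet> n < 0"
  proof -
    have "p \<bullet> n = (\<Sum>a | a \<in> D \<and> c a < 0. c a * (p \<bullet> a))" by (simp add: n_def inner_sum_right)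
    also have "\<dots> < (\<Sum>a | a \<in> D \<and> c a < 0. 0)"
      using finite_D a neg pos by (intro sum_strict_mono) (auto simp: mult_neg_pos)
    finally show ?thesis by simp
  qed
  ultimately show False by simp
qed

lemma independent_D: "independent D"
proof
  assume "dependent D"
  then obtain c v where c: "v \<in> D" "c v \<noteq> 0" "(\<Sum>a\<in>D. c a *\<^sub>R a) = 0"
    using dependent_finite[OF finite_D] by blast
  \<comment> \<open>Both \<open>c\<close> and its negative represent the zero vector.\<close>
  have "0 \<le> c a" "0 \<le> - c a" if "a \<in> D" for a
    using coeff_nonneg[of 0 c a] coeff_nonneg[of 0 "\<lambda>a. - c a" a] c(3) that by (auto simp: sum_negf)
  then show False using c(1,2) by (metis antisym neg_0_le_iff_le)
qed

end

lemma simple_system_exists: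
  fixes R :: "'a::euclidean_space set"
  assumes R: "refl_closed R" "finite R" "span R = UNIV" and gen: "\<And>r. r \<in> R \<Longrightarrow> p \<bullet> r \<noteq> 0"
  shows "\<exists>D\<subseteq>R. obtuse_system p D \<and> span D = UNIV \<and> {r\<in>R. 0 < p \<bullet> r} \<subseteq> nonneg_span D"
proof -
  define P where "P = {r\<in>R. 0 < p \<bullet> r}"
  have finP: "finite P" using R by (simp add: P_def)
  define ok where "ok = (\<lambda>D. D \<subseteq> P \<and> P \<subseteq> nonneg_span D)"
  have "ok P" using nonneg_span_base[OF finP] by (auto simp: ok_def)
  then obtain D where D: "ok D" and min: "\<And>E. ok E \<Longrightarrow> card D \<le> card E"
    using ex_has_least_nat[of ok P card] by blast
  have DP: "D \<subseteq> P" "P \<subseteq> nonneg_span D" using D by (auto simp: ok_def)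
  have finD: "finite D" using DP finP finite_subset by blast
  have posD: "0 < p \<bullet> a" if "a \<in> D" for a using that DP by (auto simp: P_def)
  have irred: "b \<notin> nonneg_span (D - {b})" if "b \<in> D" for b
  proof
    assume b: "b \<in> nonneg_span (D - {b})"
    have "D \<subseteq> nonneg_span (D - {b})" using b nonneg_span_base[of "D - {b}"] finD by blast
    then have "ok (D - {b})" using DP nonneg_span_minimal unfolding ok_def by blast
    then have "card D \<le> card (D - {b})" by (rule min)
    then show False using that finD by (metis card_Diff1_less not_le)
  qed
  have obt: "a \<bullet> b \<le> 0" if ab: "a \<in> D" "b \<in> D" "a \<noteq> b" for a b
  proof (rule ccontr)
    assume "\<not> ?thesis"
    then have c: "0 < 2 * (a \<bullet> b)" by simp
    have aR: "a \<in> R" "b \<in> R" using ab DP by (auto simp: P_def)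
    have r: "reflect a b \<in> R" using aR R refl_closedD by blast
    consider "0 < p \<bullet> reflect a b" | "0 < p \<bullet> - reflect a b" using gen[OF r] by (simp, linarith)
    then show False
    proof cases
      case 1
      then have "1 *\<^sub>R b - (2 * (a \<bullet> b)) *\<^sub>R a \<in> nonneg_span D" using r DP by (auto simp: P_def reflect_def)
      then show False using nonneg_span_absorb[OF finD posD ab c] irred[OF ab(2)] by blast
    next
      case 2
      then have "- reflect a b \<in> nonneg_span D" using r DP refl_closed_uminus[OF R(1) r] by (auto simp: P_def)
      then have "(2 * (a \<bullet> b)) *\<^sub>R a - 1 *\<^sub>R b \<in> nonneg_span D" by (simp add: reflect_def)
      then show False using nonneg_span_absorb[OF finD posD ab(2,1) _ zero_less_one] ab(3) irred[OF ab(1)] by blast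
    qed
  qed
  have "R \<subseteq> span D"
  proof
    fix r assume r: "r \<in> R"
    have nn: "nonneg_span D \<subseteq> span D" by (auto simp: nonneg_span_def intro!: span_sum span_scale intro: span_base)
    show "r \<in> span D"
    proof (cases "0 < p \<bullet> r")
      case True then show ?thesis using r DP nn by (auto simp: P_def)
    next
      case False
      then have "- r \<in> P" using gen[OF r] refl_closed_uminus[OF R(1) r] by (auto simp: P_def not_less less_le)
      then have "- r \<in> span D" using DP nn by blast
      then show ?thesis using span_neg[of "- r" D] by simp
    qed
  qed
  then have "span D = UNIV" using R(3) by (metis span_minimal subspace_span top.extremum_unique)
  moreover have "obtuse_system p D" by unfold_locales (use finD posD obt in auto)
  ultimately show ?thesis using DP P_def by blast
qed

text \<open>\<open>T\<close> inverts the map that lists the products with the simple roots, so the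
  vectors \<open>T i\<close> form the dual basis and span the edges of the chamber. The other
  positive roots add no condition, being nonnegative combinations of simple ones.\<close>

lemma chamber_coordinates:
  fixes R :: "'a::euclidean_space set"
  assumes R: "refl_closed R" "finite R" "span R = UNIV" and gen: "\<And>r. r \<in> R \<Longrightarrow> p \<bullet> r \<noteq> 0"
  shows "\<exists>T :: 'a \<Rightarrow> 'a. linear T \<and> bij T \<and> (\<forall>i\<in>Basis. \<forall>j\<in>Basis. 0 \<le> T i \<bullet> T j) \<and>
    (\<forall>x. (\<forall>r\<in>R. 0 < p \<bullet> r \<longrightarrow> 0 < r \<bullet> T x) \<longleftrightarrow> (\<forall>i\<in>Basis. 0 < x \<bullet> i)) \<and>
    (\<forall>x. (\<forall>r\<in>R. 0 < p \<bullet> r \<longrightarrow> 0 \<le> r \<bullet> T x) \<longleftrightarrow> (\<forall>i\<in>Basis. 0 \<le> x \<bullet> i))"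
proof -
  obtain D where D: "D \<subseteq> R" "obtuse_system p D" "span D = UNIV" "{r\<in>R. 0 < p \<bullet> r} \<subseteq> nonneg_span D"
    using simple_system_exists[OF R gen] by blast
  interpret obtuse_system p D by (rule D)
  have "card D = DIM('a)"
    using independent_D D(3) by (metis dim_UNIV dim_span_eq_card_independent)
  then obtain a where a: "bij_betw a (Basis :: 'a set) D"
    using finite_same_card_bij[of Basis D] finite_D by auto
  have aD: "a i \<in> D" if "i \<in> Basis" for i using a that by (auto simp: bij_betw_def)
  define A where "A = (\<lambda>x. \<Sum>i\<in>Basis. (a i \<bullet> x) *\<^sub>R i)"
  have linA: "linear A"
    by (rule linearI) (simp_all add: A_def inner_simps scaleR_add_left sum.distrib scaleR_sum_right)
  have Ai: "A x \<bullet> i = a i \<bullet> x" if "i \<in> Basis" for x i using that by (simp add: A_def)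
  have injA: "inj A"
  proof (subst linear_injective_0[OF linA], intro allI impI)
    fix x assume "A x = 0"
    then have "a i \<bullet> x = 0" if "i \<in> Basis" for i using Ai[OF that, of x] by simp
    then have "D \<subseteq> {y. y \<bullet> x = 0}" using a by (auto simp: bij_betw_def)
    then have "span D \<subseteq> {y. y \<bullet> x = 0}"
      by (rule span_minimal) (simp add: subspace_hyperplane2 inner_commute subspace_hyperplane)
    then have "x \<bullet> x = 0" using D(3) by blast
    then show "x = 0" by simp
  qed
  then have bijA: "bij A" using linear_injective_imp_surjective[OF linA] by (simp add: bij_def)
  define T where "T = inv A"
  have AT: "A (T x) = x" for x unfolding T_def using bijA by (simp add: bij_is_surj surj_f_inv_f)
  have bijT: "bij T" unfolding T_def by (rule bij_imp_bij_inv[OF bijA])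
  have linT: "linear T" unfolding T_def
    by (rule inj_linear_imp_inv_linear[OF linA injA])
  have aT: "a i \<bullet> T x = x \<bullet> i" if "i \<in> Basis" for x i using Ai[OF that, of "T x"] by (simp add: AT)
  have DT: "(\<forall>d\<in>D. 0 < d \<bullet> T x) \<longleftrightarrow> (\<forall>i\<in>Basis. 0 < x \<bullet> i)"
    "(\<forall>d\<in>D. 0 \<le> d \<bullet> T x) \<longleftrightarrow> (\<forall>i\<in>Basis. 0 \<le> x \<bullet> i)" for x
    using a aT by (auto simp: bij_betw_def)
  have rD: "(\<forall>r\<in>R. 0 < p \<bullet> r \<longrightarrow> 0 < r \<bullet> y) \<longleftrightarrow> (\<forall>d\<in>D. 0 < d \<bullet> y)" for y
  proof
    assume "\<forall>r\<in>R. 0 < p \<bullet> r \<longrightarrow> 0 < r \<bullet> y"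
    then show "\<forall>d\<in>D. 0 < d \<bullet> y" using D(1) pos by blast
  next
    assume dy: "\<forall>d\<in>D. 0 < d \<bullet> y"
    show "\<forall>r\<in>R. 0 < p \<bullet> r \<longrightarrow> 0 < r \<bullet> y"
    proof (intro ballI impI)
      fix r assume r: "r \<in> R" "0 < p \<bullet> r"
      then obtain k where k: "\<forall>d\<in>D. 0 \<le> k d" "r = (\<Sum>d\<in>D. k d *\<^sub>R d)"
        using D(4) unfolding nonneg_span_def by blast
      \<comment> \<open>Strictness needs one positive coefficient; it exists because
        \<open>0 < p \<bullet> r\<close> excludes \<open>r = 0\<close>.\<close>
      have "\<exists>d\<in>D. k d \<noteq> 0"
      proof (rule ccontr)
        assume "\<not> ?thesis"
        then have "r = 0" using k(2) by simp
        with r(2) show False by simp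
      qed
      then obtain d where d: "d \<in> D" "0 < k d" using k(1) by force
      have "r \<bullet> y = (\<Sum>d\<in>D. k d * (d \<bullet> y))" unfolding k(2) by (simp add: inner_sum_left)
      moreover have "0 < (\<Sum>d\<in>D. k d * (d \<bullet> y))"
        using finite_D d dy k(1) by (intro sum_pos2[of D d]) (auto simp: less_imp_le)
      ultimately show "0 < r \<bullet> y" by simp
    qed
  qed
  have rD': "(\<forall>r\<in>R. 0 < p \<bullet> r \<longrightarrow> 0 \<le> r \<bullet> y) \<longleftrightarrow> (\<forall>d\<in>D. 0 \<le> d \<bullet> y)" for y
  proof
    assume "\<forall>r\<in>R. 0 < p \<bullet> r \<longrightarrow> 0 \<le> r \<bullet> y"
    then show "\<forall>d\<in>D. 0 \<le> d \<bullet> y" using D(1) pos by blast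
  next
    assume "\<forall>d\<in>D. 0 \<le> d \<bullet> y"
    then show "\<forall>r\<in>R. 0 < p \<bullet> r \<longrightarrow> 0 \<le> r \<bullet> y"
      using D(4) nonneg_span_inner[of _ D y] by (auto simp: inner_commute)
  qed
  \<comment> \<open>\<open>T i\<close> has nonnegative products with \<open>D\<close>, so
    \<open>coeff_nonneg\<close> puts it into the cone generated by \<open>D\<close>, on which the
    product with \<open>T j\<close> is nonnegative.\<close>
  have acute: "0 \<le> T i \<bullet> T j" if ij: "i \<in> Basis" "j \<in> Basis" for i j
  proof -
    have nn: "\<forall>d\<in>D. 0 \<le> d \<bullet> T i" "\<forall>d\<in>D. 0 \<le> d \<bullet> T j" using ij by (auto simp: DT inner_Basis)
    have "T i \<in> span D" using D(3) by simp
    then obtain c where c: "T i = (\<Sum>d\<in>D. c d *\<^sub>R d)" unfolding span_finite[OF finite_D] by blast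
    have "0 \<le> c d" if "d \<in> D" for d by (rule coeff_nonneg[OF c]) (use nn that in auto)
    then have "T i \<in> nonneg_span D" using c unfolding nonneg_span_def by blast
    then show ?thesis using nn(2) nonneg_span_inner[of "T i" D "T j"] by (auto simp: inner_commute)
  qed
  have e1: "(\<forall>r\<in>R. 0 < p \<bullet> r \<longrightarrow> 0 < r \<bullet> T x) \<longleftrightarrow> (\<forall>i\<in>Basis. 0 < x \<bullet> i)" for x
    unfolding rD by (rule DT(1))
  have e2: "(\<forall>r\<in>R. 0 < p \<bullet> r \<longrightarrow> 0 \<le> r \<bullet> T x) \<longleftrightarrow> (\<forall>i\<in>Basis. 0 \<le> x \<bullet> i)" for x
    unfolding rD' by (rule DT(2))
  show ?thesis by (intro exI[of _ T] conjI ballI allI linT bijT acute e1 e2)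
qed

lemma generic_vector_exists:
  fixes R :: "'a::euclidean_space set"
  assumes "finite R" "\<And>r. r \<in> R \<Longrightarrow> r \<noteq> 0"
  shows "\<exists>p. \<forall>r\<in>R. p \<bullet> r \<noteq> 0"
proof -
  have "negligible (\<Union>r\<in>R. {x. r \<bullet> x = 0})"
    using assms by (intro negligible_Union) (auto intro: negligible_hyperplane)
  then have "(\<Union>r\<in>R. {x. r \<bullet> x = 0}) \<noteq> UNIV" by (metis non_negligible_UNIV)
  then show ?thesis by (auto simp: inner_commute)
qed

section \<open>Finite symmetry groups and their chambers\<close>

text \<open>A linear map is determined by its values on a spanning set, and here these values lie in
  a finite set.\<close>

lemma finite_linear_stabilizer:
  fixes R :: "'a::euclidean_space set"
  assumes "finite R" "span R = UNIV"
  shows "finite {g. linear g \<and> g ` R = R}"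
proof (rule finite_imageD)
  have "(\<lambda>g. restrict g R) ` {g. linear g \<and> g ` R = R} \<subseteq> R \<rightarrow>\<^sub>E R" by auto
  then show "finite ((\<lambda>g. restrict g R) ` {g. linear g \<and> g ` R = R})"
    by (rule finite_subset) (simp add: finite_PiE assms)
  show "inj_on (\<lambda>g. restrict g R) {g. linear g \<and> g ` R = R}"
  proof (rule inj_onI)
    fix f g :: "'a \<Rightarrow> 'a"
    assume fg: "f \<in> {g. linear g \<and> g ` R = R}" "g \<in> {g. linear g \<and> g ` R = R}" "restrict f R = restrict g R"
    have "f x = g x" for x
    proof (rule linear_eq_on_span[of f g R])
      show "f y = g y" if "y \<in> R" for y using fg(3) that by (metis restrict_apply')
    qed (use fg assms in auto)
    then show "f = g" by (rule ext)
  qed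
qed

text \<open>\<open>p\<close> decides which of \<open>r\<close> and \<open>- r\<close> counts as
  positive. \<open>G\<close> has to contain the reflections but need not be generated by
  them.\<close>

locale finite_reflection_group =
  fixes R :: "'a::euclidean_space set" and G :: "('a \<Rightarrow> 'a) set" and p :: 'a
  assumes R: "refl_closed R" "finite R" "span R = UNIV"
    and gen: "r \<in> R \<Longrightarrow> p \<bullet> r \<noteq> 0"
    and finite_G: "finite G"
    and orth: "g \<in> G \<Longrightarrow> orthogonal_transformation g"
    and image_R: "g \<in> G \<Longrightarrow> g ` R = R"
    and id_G: "id \<in> G"
    and comp_G: "g \<in> G \<Longrightarrow> h \<in> G \<Longrightarrow> g \<circ> h \<in> G"
    and inv_G: "g \<in> G \<Longrightarrow> inv g \<in> G"
    and reflect_G: "r \<in> R \<Longrightarrow> reflect r \<in> G"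
begin

definition chamber :: "'a set" where
  "chamber = {x. \<forall>r\<in>R. 0 < p \<bullet> r \<longrightarrow> 0 < r \<bullet> x}"

definition walls :: "'a set" where
  "walls = (\<Union>r\<in>R. {x. r \<bullet> x = 0})"

lemma p_chamber: "p \<in> chamber"
  by (auto simp: chamber_def inner_commute)

lemma open_chamber: "open chamber"
proof -
  have "chamber = (\<Inter>r\<in>{r\<in>R. 0 < p \<bullet> r}. {x. 0 < r \<bullet> x})" by (auto simp: chamber_def)
  also have "open \<dots>" using R(2) by (intro open_INT) (auto intro!: open_Collect_less continuous_intros)
  finally show ?thesis .
qed

lemma inv_inner:
  assumes "g \<in> G"
  shows "inv g x \<bullet> y = x \<bullet> g y"
proof -
  have "inv g x \<bullet> y = g (inv g x) \<bullet> g y"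
    using orth[OF assms] by (simp add: orthogonal_transformation_def)
  also have "g (inv g x) = x"
    using orthogonal_transformation_bij[OF orth[OF assms]] by (simp add: bij_is_surj surj_f_inv_f)
  finally show ?thesis .
qed

text \<open>Reflecting in a root that separates \<open>g x\<close> from \<open>z\<close> would increase the inner product.\<close>

lemma move_to_chamber:
  assumes z: "z \<in> chamber"
  obtains g where "g \<in> G" "\<And>r. r \<in> R \<Longrightarrow> 0 < p \<bullet> r \<Longrightarrow> 0 \<le> r \<bullet> g x" "z \<bullet> x \<le> z \<bullet> g x"
proof -
  have "finite ((\<lambda>g. z \<bullet> g x) ` G)" "(\<lambda>g. z \<bullet> g x) ` G \<noteq> {}" using finite_G id_G by auto
  from Max_in[OF this] obtain g where g: "g \<in> G" "Max ((\<lambda>g. z \<bullet> g x) ` G) = z \<bullet> g x" by blast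
  have max: "z \<bullet> h x \<le> z \<bullet> g x" if "h \<in> G" for h
    unfolding g(2)[symmetric] using finite_G that by (intro Max_ge) auto
  have "0 \<le> r \<bullet> g x" if r: "r \<in> R" "0 < p \<bullet> r" for r
  proof (rule ccontr)
    assume "\<not> ?thesis"
    moreover have "0 < r \<bullet> z" using z r unfolding chamber_def by blast
    ultimately have "(r \<bullet> g x) * (r \<bullet> z) < 0" by (simp add: mult_neg_pos)
    moreover have "z \<bullet> (reflect r \<circ> g) x \<le> z \<bullet> g x" by (intro max g(1) comp_G reflect_G r)
    moreover have "z \<bullet> (reflect r \<circ> g) x = z \<bullet> g x - 2 * ((r \<bullet> g x) * (r \<bullet> z))"
      by (simp add: reflect_def inner_diff_right inner_commute[of z r])
    ultimately show False by linarith
  qed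
  moreover have "z \<bullet> x \<le> z \<bullet> g x" using max[OF id_G] by simp
  ultimately show ?thesis using that g(1) by blast
qed

lemma chamber_sign:
  assumes "y \<in> chamber" "r \<in> R"
  shows "0 < r \<bullet> y \<longleftrightarrow> 0 < p \<bullet> r"
proof
  assume *: "0 < r \<bullet> y"
  show "0 < p \<bullet> r"
  proof (rule ccontr)
    assume "\<not> ?thesis"
    then have "0 < p \<bullet> - r" using gen[OF assms(2)] by simp
    then have "0 < - r \<bullet> y" using assms refl_closed_uminus[OF R(1)] unfolding chamber_def by blast
    with * show False by simp
  qed
qed (use assms in \<open>auto simp: chamber_def\<close>)

text \<open>Elements of \<open>G\<close> permute \<open>R\<close>, so membership of
  \<open>h y\<close> in the chamber depends only on the signs of the roots at \<open>y\<close>, and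
  these are constant on the chamber.\<close>

lemma apply_chamber_iff:
  assumes y: "y \<in> chamber" and h: "h \<in> G"
  shows "h y \<in> chamber \<longleftrightarrow> h p \<in> chamber"
proof -
  have inv_R: "inv h r \<in> R" if "r \<in> R" for r using image_R[OF inv_G[OF h]] that by blast
  have "0 < r \<bullet> h y \<longleftrightarrow> 0 < r \<bullet> h p" if "r \<in> R" for r
    using chamber_sign[OF y inv_R[OF that]] chamber_sign[OF p_chamber inv_R[OF that]]
    by (simp add: inv_inner[OF h])
  then show ?thesis by (simp add: chamber_def)
qed

text \<open>By \<open>apply_chamber_iff\<close> this counts the elements of \<open>G\<close> that
  map the chamber into itself; \<open>p\<close> stands for any of its points.\<close>

definition mult :: nat where
  "mult = card {h\<in>G. h p \<in> chamber}"

lemma mult_pos: "0 < mult"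
proof -
  have "id \<in> {h\<in>G. h p \<in> chamber}" using id_G p_chamber by simp
  moreover have "finite {h\<in>G. h p \<in> chamber}" using finite_G by simp
  ultimately show ?thesis unfolding mult_def card_gt_0_iff by blast
qed

text \<open>Off the walls some \<open>g\<close> moves \<open>x\<close> into the open chamber, and
  composition with \<open>g\<close> matches the elements counted at \<open>p\<close> with those
  counted at \<open>x\<close>.\<close>

lemma card_chamber_orbit:
  assumes x: "x \<notin> walls"
  shows "card {g\<in>G. g x \<in> chamber} = mult"
proof -
  obtain g where g: "g \<in> G" "\<And>r. r \<in> R \<Longrightarrow> 0 < p \<bullet> r \<Longrightarrow> 0 \<le> r \<bullet> g x"
    using move_to_chamber[OF p_chamber, of x] by blast
  have "r \<bullet> g x \<noteq> 0" if "r \<in> R" for r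
  proof -
    have "inv g r \<in> R" using image_R[OF inv_G[OF g(1)]] that by blast
    then show ?thesis using x inv_inner[OF g(1), of r x] by (auto simp: walls_def)
  qed
  then have gx: "g x \<in> chamber" using g(2) by (force simp: chamber_def less_le)
  have bij: "bij g" using orth[OF g(1)] by (rule orthogonal_transformation_bij)
  have "bij_betw (\<lambda>h. h \<circ> g) {h\<in>G. h p \<in> chamber} {k\<in>G. k x \<in> chamber}"
  proof (rule bij_betw_byWitness[where f' = "\<lambda>k. k \<circ> inv g"])
    show "\<forall>h\<in>{h \<in> G. h p \<in> chamber}. h \<circ> g \<circ> inv g = h"
      using bij by (auto simp: fun_eq_iff bij_is_surj surj_f_inv_f)
    show "\<forall>k\<in>{k \<in> G. k x \<in> chamber}. k \<circ> inv g \<circ> g = k"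
      using bij by (auto simp: fun_eq_iff bij_is_inj)
    show "(\<lambda>h. h \<circ> g) ` {h \<in> G. h p \<in> chamber} \<subseteq> {k \<in> G. k x \<in> chamber}"
      using comp_G g(1) apply_chamber_iff[OF gx] by auto
    show "(\<lambda>k. k \<circ> inv g) ` {k \<in> G. k x \<in> chamber} \<subseteq> {h \<in> G. h p \<in> chamber}"
    proof clarify
      fix k assume k: "k \<in> G" "k x \<in> chamber"
      have "k \<circ> inv g \<in> G" using comp_G inv_G g(1) k by blast
      moreover have "(k \<circ> inv g) (g x) \<in> chamber" using k bij by (simp add: bij_is_inj)
      ultimately show "k \<circ> inv g \<in> G \<and> (k \<circ> inv g) p \<in> chamber" using apply_chamber_iff[OF gx] by blast
    qed
  qed
  from bij_betw_same_card[OF this] show ?thesis by (simp add: mult_def)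
qed

text \<open>Double counting of the pieces of \<open>K\<close> that the elements of \<open>G\<close>
  send into the chamber: all have the same measure, and almost every point of \<open>K\<close> lies
  in exactly \<open>mult\<close> of them.\<close>

lemma emeasure_chamber_part:
  fixes M :: "'a measure"
  assumes sets_M: "sets M = sets borel" and K: "K \<in> sets borel"
    and inv_M: "\<And>g A. g \<in> G \<Longrightarrow> A \<in> sets borel \<Longrightarrow> emeasure M (g -` A) = emeasure M A"
    and walls_M: "AE x in M. x \<notin> walls"
    and inv_K: "\<And>g. g \<in> G \<Longrightarrow> g -` K = K"
  shows "of_nat mult * emeasure M K = of_nat (card G) * emeasure M (K \<inter> chamber)"
proof -
  have C: "chamber \<in> sets borel" using open_chamber by simp
  have gC: "g -` chamber \<in> sets borel" if "g \<in> G" for g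
  proof -
    have "continuous_on UNIV g" using orth[OF that] by (simp add: linear_continuous_on linear_linear orthogonal_transformation_def)
    then show ?thesis using open_vimage[OF open_chamber] by (intro borel_open)
  qed
  have meas: "(indicator (K \<inter> g -` chamber) :: 'a \<Rightarrow> ennreal) \<in> borel_measurable M" if "g \<in> G" for g
    using K gC[OF that] sets_M by (intro borel_measurable_indicator) auto
  have "of_nat (card G) * emeasure M (K \<inter> chamber) = (\<Sum>g\<in>G. emeasure M (K \<inter> g -` chamber))"
  proof -
    have "emeasure M (K \<inter> g -` chamber) = emeasure M (K \<inter> chamber)" if "g \<in> G" for g
    proof -
      have "K \<inter> g -` chamber = g -` (K \<inter> chamber)" using inv_K[OF that] by auto
      then show ?thesis using inv_M[OF that, of "K \<inter> chamber"] K C by auto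
    qed
    then show ?thesis by simp
  qed
  also have "\<dots> = (\<Sum>g\<in>G. \<integral>\<^sup>+x. indicator (K \<inter> g -` chamber) x \<partial>M)"
    using K gC sets_M by (intro sum.cong) auto
  also have "\<dots> = (\<integral>\<^sup>+x. (\<Sum>g\<in>G. indicator (K \<inter> g -` chamber) x) \<partial>M)"
    by (intro nn_integral_sum[symmetric] meas)
  also have "\<dots> = (\<integral>\<^sup>+x. of_nat mult * indicator K x \<partial>M)"
  proof (rule nn_integral_cong_AE, use walls_M in eventually_elim)
    fix x assume x: "x \<notin> walls"
    have "(\<Sum>g\<in>G. indicator (K \<inter> g -` chamber) x :: ennreal) = (\<Sum>g\<in>G. indicator K x * (if g x \<in> chamber then 1 else 0))"
      by (intro sum.cong) (auto simp: indicator_def)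
    also have "\<dots> = indicator K x * of_nat (card {g\<in>G. g x \<in> chamber})"
      using finite_G by (simp add: sum_distrib_left[symmetric] sum.If_cases Int_def)
    finally show "(\<Sum>g\<in>G. indicator (K \<inter> g -` chamber) x :: ennreal) = of_nat mult * indicator K x"
      by (simp add: card_chamber_orbit[OF x] mult.commute)
  qed
  also have "\<dots> = of_nat mult * emeasure M K"
    using K sets_M by (simp add: nn_integral_cmult_indicator)
  finally show ?thesis by simp
qed

end

section \<open>Linear changes of variables\<close>

lemma nn_integral_lborel_translation:
  fixes f :: "'a::euclidean_space \<Rightarrow> ennreal"
  assumes [measurable]: "f \<in> borel_measurable borel"
  shows "(\<integral>\<^sup>+x. f (a + x) \<partial>lborel) = (\<integral>\<^sup>+x. f x \<partial>lborel)"
proof -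
  have "(\<integral>\<^sup>+x. f x \<partial>lborel) = (\<integral>\<^sup>+x. f x \<partial>distr lborel borel ((+) a))"
    by (simp only: lborel_distr_plus)
  then show ?thesis by (simp add: nn_integral_distr)
qed

text \<open>Uniqueness of the Haar measure: evaluate \<open>\<integral>\<integral> f(x) g(y) dM(x) dy\<close> by the substitutions
  \<open>x \<mapsto> x + y\<close> and \<open>y \<mapsto> y - x\<close>, \<open>g\<close> being the indicator of the unit ball.\<close>

lemma translation_invariant_measure_unique:
  fixes M :: "'a::euclidean_space measure"
  assumes sf: "sigma_finite_measure M" and sets_M [measurable_cong]: "sets M = sets borel"
    and inv_M: "\<And>a f. f \<in> borel_measurable borel \<Longrightarrow> (\<integral>\<^sup>+x. f (a + x) \<partial>M) = (\<integral>\<^sup>+x. f x \<partial>M)"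
    and f [measurable]: "f \<in> borel_measurable borel"
  shows "emeasure lborel (ball 0 1 :: 'a set) * (\<integral>\<^sup>+x. f x \<partial>M) = emeasure M (ball 0 1) * (\<integral>\<^sup>+x. f x \<partial>lborel)"
proof -
  interpret M: sigma_finite_measure M by (rule sf)
  interpret P: pair_sigma_finite M "lborel :: 'a measure" ..
  define g :: "'a \<Rightarrow> ennreal" where "g = indicator (ball 0 1)"
  have [measurable]: "g \<in> borel_measurable borel" unfolding g_def by (rule borel_measurable_indicator) simp
  have gsym: "g (- x) = g x" for x by (simp add: g_def indicator_def)
  have "emeasure lborel (ball 0 1 :: 'a set) * (\<integral>\<^sup>+x. f x \<partial>M) = (\<integral>\<^sup>+y. g y \<partial>lborel) * (\<integral>\<^sup>+x. f x \<partial>M)"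
    by (simp add: g_def)
  also have "\<dots> = (\<integral>\<^sup>+y. g y * (\<integral>\<^sup>+x. f (y + x) \<partial>M) \<partial>lborel)"
    by (simp add: inv_M nn_integral_multc)
  also have "\<dots> = (\<integral>\<^sup>+y. (\<integral>\<^sup>+x. g y * f (y + x) \<partial>M) \<partial>lborel)"
    by (intro nn_integral_cong nn_integral_cmult[symmetric]) measurable
  also have "\<dots> = (\<integral>\<^sup>+x. (\<integral>\<^sup>+y. g y * f (y + x) \<partial>lborel) \<partial>M)"
    by (rule P.Fubini') measurable
  also have "\<dots> = (\<integral>\<^sup>+x. (\<integral>\<^sup>+y. g (- x + y) * f y \<partial>lborel) \<partial>M)"
  proof (rule nn_integral_cong)
    fix x
    show "(\<integral>\<^sup>+y. g y * f (y + x) \<partial>lborel) = (\<integral>\<^sup>+y. g (- x + y) * f y \<partial>lborel)"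
      using nn_integral_lborel_translation[of "\<lambda>y. g y * f (y + x)" "- x"] by simp
  qed
  also have "\<dots> = (\<integral>\<^sup>+y. (\<integral>\<^sup>+x. g (- x + y) * f y \<partial>M) \<partial>lborel)"
    by (rule P.Fubini'[symmetric]) measurable
  also have "\<dots> = (\<integral>\<^sup>+y. (\<integral>\<^sup>+x. g x \<partial>M) * f y \<partial>lborel)"
  proof (rule nn_integral_cong)
    fix y
    have "(\<integral>\<^sup>+x. g (- x + y) * f y \<partial>M) = (\<integral>\<^sup>+x. g (- x + y) \<partial>M) * f y"
      by (rule nn_integral_multc) measurable
    also have "(\<integral>\<^sup>+x. g (- x + y) \<partial>M) = (\<integral>\<^sup>+x. g (- (y + x) + y) \<partial>M)"
      by (rule inv_M[of "\<lambda>x. g (- x + y)" y, symmetric]) measurable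
    finally show "(\<integral>\<^sup>+x. g (- x + y) * f y \<partial>M) = (\<integral>\<^sup>+x. g x \<partial>M) * f y" by (simp add: gsym)
  qed
  also have "\<dots> = emeasure M (ball 0 1) * (\<integral>\<^sup>+x. f x \<partial>lborel)"
    by (simp add: nn_integral_cmult g_def)
  finally show ?thesis .
qed

text \<open>The image of Lebesgue measure under \<open>T\<close> is translation invariant, so
  uniqueness makes it a multiple of Lebesgue measure. The factor is expressed by the unit ball
  instead of a determinant.\<close>

lemma nn_integral_lborel_linear:
  fixes T :: "'a::euclidean_space \<Rightarrow> 'a"
  assumes T: "linear T" "bij T" and f [measurable]: "f \<in> borel_measurable borel"
  shows "emeasure lborel (ball 0 1 :: 'a set) * (\<integral>\<^sup>+x. f (T x) \<partial>lborel) =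
    emeasure lborel (T -` ball 0 1) * (\<integral>\<^sup>+x. f x \<partial>lborel)"
proof -
  have Tm [measurable]: "T \<in> borel_measurable borel"
    using T by (intro borel_measurable_continuous_onI linear_continuous_on) (simp add: linear_linear)
  define M where "M = distr lborel borel T"
  have sM: "sets M = sets borel" by (simp add: M_def)
  have linI: "linear (inv T)" using T by (intro inj_linear_imp_inv_linear) (auto simp: bij_def)
  have bdd: "bounded (T -` ball 0 r)" for r
  proof -
    have "T -` ball 0 r = inv T ` ball 0 r" using T by (simp add: bij_vimage_eq_inv_image)
    then show ?thesis using linI by (auto intro!: bounded_linear_image simp: linear_linear)
  qed
  have [measurable]: "T -` ball 0 r \<in> sets borel" for r using measurable_sets_borel[OF Tm, of "ball 0 r"] by simp
  have fin: "emeasure M (ball 0 r) < \<infinity>" for r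
    unfolding M_def using emeasure_bounded_finite[OF bdd[of r]] by (subst emeasure_distr) auto
  have sf: "sigma_finite_measure M"
  proof (standard, intro exI conjI)
    show "countable (range (\<lambda>n::nat. ball 0 (real n) :: 'a set))" by simp
    show "range (\<lambda>n::nat. ball 0 (real n)) \<subseteq> sets M" by (auto simp: M_def)
    show "\<Union> (range (\<lambda>n::nat. ball (0::'a) (real n))) = space M"
      using reals_Archimedean2 by (auto simp: M_def)
    show "\<forall>a\<in>range (\<lambda>n::nat. ball 0 (real n)). emeasure M a \<noteq> \<infinity>"
      using fin by (auto simp: less_top)
  qed
  have inv_M: "(\<integral>\<^sup>+x. h (a + x) \<partial>M) = (\<integral>\<^sup>+x. h x \<partial>M)" if [measurable]: "h \<in> borel_measurable borel" for a h
  proof -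
    have "(\<integral>\<^sup>+x. h (a + x) \<partial>M) = (\<integral>\<^sup>+x. h (T (inv T a + x)) \<partial>lborel)"
      using T by (simp add: M_def nn_integral_distr linear_add bij_is_surj surj_f_inv_f)
    also have "\<dots> = (\<integral>\<^sup>+x. h (T x) \<partial>lborel)"
      using nn_integral_lborel_translation[of "\<lambda>x. h (T x)" "inv T a"] by simp
    finally show ?thesis by (simp add: M_def nn_integral_distr)
  qed
  have "emeasure lborel (ball 0 1 :: 'a set) * (\<integral>\<^sup>+x. f x \<partial>M) = emeasure M (ball 0 1) * (\<integral>\<^sup>+x. f x \<partial>lborel)"
    by (rule translation_invariant_measure_unique[OF sf sM inv_M f])
  then show ?thesis by (simp add: M_def nn_integral_distr emeasure_distr)
qed

lemma emeasure_unit_ball_pos: "0 < emeasure lborel (ball 0 1 :: 'a::euclidean_space set)"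
  using emeasure_lborel_ball_finite[of "0::'a" 1] content_ball_pos[of 1 "0::'a"]
  by (simp add: emeasure_eq_ennreal_measure less_top)

lemma nn_integral_lborel_orthogonal:
  fixes T :: "'a::euclidean_space \<Rightarrow> 'a"
  assumes T: "orthogonal_transformation T" and f: "f \<in> borel_measurable borel"
  shows "(\<integral>\<^sup>+x. f (T x) \<partial>lborel) = (\<integral>\<^sup>+x. f x \<partial>lborel)"
proof -
  have "T -` ball 0 1 = ball 0 1" using T by (auto simp: orthogonal_transformation_norm)
  then have "emeasure lborel (ball 0 1 :: 'a set) * (\<integral>\<^sup>+x. f (T x) \<partial>lborel) =
    emeasure lborel (ball 0 1 :: 'a set) * (\<integral>\<^sup>+x. f x \<partial>lborel)"
    using nn_integral_lborel_linear[OF _ orthogonal_transformation_bij[OF T] f] T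
    by (simp add: orthogonal_transformation_def)
  then show ?thesis
    using emeasure_unit_ball_pos[where 'a='a] emeasure_lborel_ball_finite[of "0::'a" 1]
    by (auto simp: ennreal_mult_cancel_left)
qed

lemma linear_change_of_variables_constant:
  fixes T :: "'a::euclidean_space \<Rightarrow> 'a"
  assumes T: "linear T" "bij T"
  shows "\<exists>c>0. \<forall>f\<in>borel_measurable borel. (\<integral>\<^sup>+x. f (T x) \<partial>lborel) = ennreal c * (\<integral>\<^sup>+x. f x \<partial>lborel)"
proof -
  let ?B = "ball 0 1 :: 'a set"
  obtain b where b: "0 < b" "emeasure lborel ?B = ennreal b"
    using emeasure_unit_ball_pos[where 'a='a] emeasure_lborel_ball_finite[of "0::'a" 1]
    by (cases "emeasure lborel ?B") auto
  have "T -` ?B = inv T ` ?B" using T by (simp add: bij_vimage_eq_inv_image)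
  moreover have "linear (inv T)" using T by (intro inj_linear_imp_inv_linear) (auto simp: bij_def)
  ultimately have "bounded (T -` ?B)" by (auto intro!: bounded_linear_image simp: linear_linear)
  then have "emeasure lborel (T -` ?B) < \<infinity>" by (rule emeasure_bounded_finite)
  then obtain d where d: "0 \<le> d" "emeasure lborel (T -` ?B) = ennreal d"
    by (cases "emeasure lborel (T -` ?B)") auto
  have eq: "ennreal b * (\<integral>\<^sup>+x. f (T x) \<partial>lborel) = ennreal d * (\<integral>\<^sup>+x. f x \<partial>lborel)"
    if "f \<in> borel_measurable borel" for f
    using nn_integral_lborel_linear[OF T that] b d by simp
  \<comment> \<open>The constant function 1 has infinite integral on both sides, which excludes the
    factor 0.\<close>
  have "d \<noteq> 0"
    using eq[of "\<lambda>_. 1"] b by (auto simp: ennreal_mult_top ennreal_eq_0_iff)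
  then have "0 < d / b" using b d by simp
  moreover have "(\<integral>\<^sup>+x. f (T x) \<partial>lborel) = ennreal (d / b) * (\<integral>\<^sup>+x. f x \<partial>lborel)"
    if f: "f \<in> borel_measurable borel" for f
  proof -
    have "ennreal (1 / b) * (ennreal b * (\<integral>\<^sup>+x. f (T x) \<partial>lborel)) = ennreal (1 / b) * (ennreal d * (\<integral>\<^sup>+x. f x \<partial>lborel))"
      by (simp only: eq[OF f])
    moreover have "ennreal (1 / b) * ennreal b = 1" "ennreal (1 / b) * ennreal d = ennreal (d / b)"
      using b d by (simp_all flip: ennreal_mult)
    ultimately show ?thesis by (simp add: mult.assoc[symmetric])
  qed
  ultimately show ?thesis by blast
qed

section \<open>The \<open>L\<^sub>0\<close>-sum in a chamber\<close>

lemma gm_le_cancel: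
  assumes "gm_le l (ennreal c * p) (ennreal c * q) (ennreal c * r)" "0 < c"
  shows "gm_le l p q r"
proof -
  have c: "ennreal (1 / c) * (ennreal c * x) = x" for x
    using assms(2) by (simp add: mult.assoc[symmetric] flip: ennreal_mult)
  have "(1 / c) powr (1 - l) * (1 / c) powr l = 1 / c"
    using assms(2) by (simp flip: powr_add)
  with gm_le_scale[OF assms(1), of "1 / c" "1 / c"] assms(2) show ?thesis by (simp only: c) simp
qed

lemma gm_le_cmult:
  assumes "gm_le l p q r" "0 < c"
  shows "gm_le l (ennreal c * p) (ennreal c * q) (ennreal c * r)"
proof -
  have "c powr (1 - l) * c powr l = c" using assms(2) by (simp flip: powr_add)
  with gm_le_scale[OF assms(1), of c c] assms(2) show ?thesis by simp
qed

text \<open>As \<open>gm_le\<close> tests only numbers strictly below \<open>p\<close> and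
  \<open>q\<close>, it is used at \<open>t * p\<close> and \<open>t * q\<close> with
  \<open>t < 1\<close>; by homogeneity this costs a factor \<open>t\<close>.\<close>

lemma gm_le_ennreal:
  assumes "gm_le l (ennreal p) (ennreal q) (ennreal r)" "0 \<le> p" "0 \<le> q" "0 \<le> r"
  shows "p powr (1 - l) * q powr l \<le> r"
proof (cases "p = 0 \<or> q = 0")
  case False
  show ?thesis
  proof (rule field_le_mult_one_interval)
    fix t :: real assume t: "0 < t" "t < 1"
    have "ennreal ((t * p) powr (1 - l) * (t * q) powr l) \<le> ennreal r"
      using False assms t by (intro gm_leD[OF assms(1)]) (auto simp: ennreal_less_iff)
    then have "(t * p) powr (1 - l) * (t * q) powr l \<le> r" using assms by (simp add: ennreal_le_iff)
    moreover have "(t * p) powr (1 - l) * (t * q) powr l = (t powr (1 - l) * t powr l) * (p powr (1 - l) * q powr l)"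
      using t assms by (simp add: powr_mult)
    moreover have "t powr (1 - l) * t powr l = t" using t by (simp flip: powr_add)
    ultimately show "t * (p powr (1 - l) * q powr l) \<le> r" by simp
  qed
qed (use assms in auto)

text \<open>Weighted Hoelder inequality: after division by the totals \<open>X\<close> and
  \<open>Y\<close>, the inequality of arithmetic and geometric means holds term by term, and the
  arithmetic means add up to 1. If all weights vanish, both sides are 0.\<close>

lemma sum_powr_le:
  fixes w x y :: "'i \<Rightarrow> real"
  assumes l: "0 < l" "l < 1" and fin: "finite I"
    and nn: "\<And>i. i \<in> I \<Longrightarrow> 0 \<le> w i" "\<And>i. i \<in> I \<Longrightarrow> 0 < x i" "\<And>i. i \<in> I \<Longrightarrow> 0 < y i"
  shows "(\<Sum>i\<in>I. x i powr (1 - l) * y i powr l * w i) \<le> (\<Sum>i\<in>I. x i * w i) powr (1 - l) * (\<Sum>i\<in>I. y i * w i) powr l"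
proof (cases "\<exists>i\<in>I. w i \<noteq> 0")
  case True
  define X Y where "X = (\<Sum>i\<in>I. x i * w i)" and "Y = (\<Sum>i\<in>I. y i * w i)"
  obtain i where i: "i \<in> I" "0 < w i" using True nn(1) by force
  have X: "0 < X" and Y: "0 < Y"
    unfolding X_def Y_def using i nn fin by (auto intro!: sum_pos2[of I i] simp: less_imp_le)
  have "(\<Sum>i\<in>I. x i powr (1 - l) * y i powr l * w i)
     \<le> (\<Sum>i\<in>I. X powr (1 - l) * Y powr l * ((1 - l) * (x i * w i / X) + l * (y i * w i / Y)))"
  proof (rule sum_mono)
    fix i assume i: "i \<in> I"
    have "x i powr (1 - l) * y i powr l * w i = X powr (1 - l) * Y powr l * (((x i / X) powr (1 - l) * (y i / Y) powr l) * w i)"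
      using X Y nn(2,3)[OF i] by (simp add: powr_divide)
    also have "\<dots> \<le> X powr (1 - l) * Y powr l * (((1 - l) * (x i / X) + l * (y i / Y)) * w i)"
      using Youngs_inequality_0[of "1 - l" l "x i / X" "y i / Y"] l X Y nn[OF i]
      by (intro mult_left_mono mult_right_mono) auto
    finally show "x i powr (1 - l) * y i powr l * w i
       \<le> X powr (1 - l) * Y powr l * ((1 - l) * (x i * w i / X) + l * (y i * w i / Y))"
      by (simp add: algebra_simps)
  qed
  also have "\<dots> = X powr (1 - l) * Y powr l * ((1 - l) * (X / X) + l * (Y / Y))"
    by (simp only: X_def Y_def sum_distrib_left[symmetric] sum.distrib sum_divide_distrib[symmetric])
  also have "\<dots> = X powr (1 - l) * Y powr l" using X Y by simp
  finally show ?thesis by (simp add: X_def Y_def)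
qed simp

text \<open>Monotonicity replaces \<open>c\<close> by the mean of \<open>a\<close> and
  \<open>b\<close>, where convexity applies. An infinite value at \<open>a\<close> or
  \<open>b\<close> gives density 0, for which \<open>gm_le\<close> is void.\<close>

lemma gm_le_exp_neg:
  assumes l: "0 < l" "l < 1" and mono: "mono_on {0..} \<psi>" and conv: "ext_convex_on {0..} \<psi>"
    and a: "0 \<le> a" and b: "0 \<le> b" and c: "0 \<le> c" "c \<le> (1 - l) * a + l * b"
  shows "gm_le l (exp_neg (\<psi> a)) (exp_neg (\<psi> b)) (exp_neg (\<psi> c))"
proof (cases "\<psi> a = \<infinity> \<or> \<psi> b = \<infinity>")
  case False
  have "\<psi> a \<noteq> -\<infinity>" "\<psi> b \<noteq> -\<infinity>" using conv a b by (auto simp: ext_convex_on_def)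
  with False obtain r s where rs: "\<psi> a = ereal r" "\<psi> b = ereal s" by (metis ereal_cases)
  have "\<psi> c \<le> \<psi> ((1 - l) * a + l * b)" using mono c by (auto simp: mono_on_def)
  also have "\<dots> \<le> ereal (1 - l) * \<psi> a + ereal l * \<psi> b"
    using conv a b l by (auto simp: ext_convex_on_def)
  finally have "\<psi> c \<le> ereal ((1 - l) * r + l * s)" by (simp add: rs)
  then have "exp_neg (ereal ((1 - l) * r + l * s)) \<le> exp_neg (\<psi> c)" by (rule antimono_exp_neg)
  then have *: "ennreal (exp (- ((1 - l) * r + l * s))) \<le> exp_neg (\<psi> c)" by (simp add: exp_neg_def)
  show ?thesis
  proof (rule gm_leI)
    fix a' b' :: real assume ab: "0 < a'" "0 < b'" "ennreal a' < exp_neg (\<psi> a)" "ennreal b' < exp_neg (\<psi> b)"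
    then have "a' \<le> exp (- r)" "b' \<le> exp (- s)" by (auto simp: rs exp_neg_def ennreal_less_iff)
    then have "a' powr (1 - l) * b' powr l \<le> exp (- r) powr (1 - l) * exp (- s) powr l"
      using ab l by (intro mult_mono powr_mono2) auto
    also have "\<dots> = exp (- ((1 - l) * r + l * s))" by (simp add: powr_def algebra_simps flip: exp_add)
    finally show "ennreal (a' powr (1 - l) * b' powr l) \<le> exp_neg (\<psi> c)"
      using * by (meson ennreal_leI order_trans)
  qed
qed (auto simp: exp_neg_def)

lemma support_fun_upper:
  assumes "bounded K" "y \<in> K"
  shows "y \<bullet> u \<le> support_fun K u"
proof -
  have "bounded ((\<lambda>y. u \<bullet> y) ` K)"
    using assms(1) by (rule bounded_linear_image) (rule bounded_linear_inner_right)
  then have "bdd_above ((\<lambda>y. u \<bullet> y) ` K)" by (rule bounded_imp_bdd_above)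
  then show ?thesis unfolding support_fun_def using assms(2) by (subst inner_commute) (rule cSUP_upper)
qed

lemma support_fun_le:
  assumes "\<And>y. y \<in> K \<Longrightarrow> norm y \<le> B" "K \<noteq> {}" "norm u = 1"
  shows "support_fun K u \<le> B"
  unfolding support_fun_def
proof (rule cSUP_least[OF assms(2)])
  fix y assume "y \<in> K"
  have "u \<bullet> y \<le> norm u * norm y" by (rule norm_cauchy_schwarz)
  then show "u \<bullet> y \<le> B" using assms(1)[OF \<open>y \<in> K\<close>] assms(3) by simp
qed

lemma support_fun_orthogonal:
  assumes "orthogonal_transformation g" "g ` K = K"
  shows "support_fun K (g u) = support_fun K u"
proof -
  have "(\<lambda>y. g u \<bullet> y) ` K = (\<lambda>y. g u \<bullet> y) ` g ` K"
    by (simp only: assms(2))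
  also have "\<dots> = (\<lambda>y. g u \<bullet> g y) ` K" by (rule image_image)
  also have "\<dots> = (\<lambda>y. u \<bullet> y) ` K" using assms(1) by (simp add: orthogonal_transformation_def)
  finally show ?thesis by (simp add: support_fun_def)
qed

lemma closed_L0_sum: "closed (L0_sum l K L)"
proof -
  have "L0_sum l K L = (\<Inter>u\<in>sphere 0 1. {x. u \<bullet> x \<le> support_fun K u powr (1 - l) * support_fun L u powr l})"
    by (auto simp: L0_sum_def inner_commute)
  then show ?thesis by (simp add: closed_INT closed_halfspace_le)
qed

lemma L0_sum_orthogonal:
  fixes K L :: "'a::euclidean_space set"
  assumes g: "orthogonal_transformation g" "g ` K = K" "g ` L = L"
  shows "g -` L0_sum l K L = L0_sum l K L"
proof -
  have "(\<forall>u\<in>sphere 0 1. g x \<bullet> u \<le> support_fun K u powr (1 - l) * support_fun L u powr l) \<longleftrightarrow>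
    (\<forall>u\<in>sphere 0 1. x \<bullet> u \<le> support_fun K u powr (1 - l) * support_fun L u powr l)" (is "?A \<longleftrightarrow> ?B") for x
  proof -
    have surj: "g ` sphere 0 1 = sphere (0::'a) 1"
    proof
      show "sphere 0 1 \<subseteq> g ` sphere 0 1"
      proof
        fix u :: 'a assume u: "u \<in> sphere 0 1"
        obtain v where v: "u = g v" using orthogonal_transformation_surj[OF g(1)] by (rule surjE)
        with u have "norm v = 1" by (simp add: orthogonal_transformation_norm[OF g(1)])
        with v show "u \<in> g ` sphere 0 1" by simp
      qed
    qed (auto simp: orthogonal_transformation_norm[OF g(1)])
    have "?A \<longleftrightarrow> (\<forall>u\<in>g ` sphere 0 1. g x \<bullet> u \<le> support_fun K u powr (1 - l) * support_fun L u powr l)"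
      by (simp only: surj)
    also have "\<dots> \<longleftrightarrow> ?B"
      using g(1) by (simp add: support_fun_orthogonal[OF g(1) g(2)] support_fun_orthogonal[OF g(1) g(3)] orthogonal_transformation_def)
    finally show ?thesis .
  qed
  then show ?thesis by (auto simp: L0_sum_def)
qed

section \<open>Common symmetries of two sets\<close>

lemma reflect_image_eqI:
  assumes "norm u = 1" "\<And>x. x \<in> K \<Longrightarrow> reflect u x \<in> K"
  shows "reflect u ` K = K"
proof
  show "K \<subseteq> reflect u ` K"
  proof
    fix x assume "x \<in> K"
    then have "reflect u x \<in> K" by (rule assms(2))
    then show "x \<in> reflect u ` K" by (rule rev_image_eqI) (simp add: reflect_reflect assms(1))
  qed
qed (use assms in auto)

lemma refl_closed_symmetries:
  fixes K L :: "'a::euclidean_space set"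
  defines "S \<equiv> {u. norm u = 1 \<and> reflect u ` K = K \<and> reflect u ` L = L}"
  shows "refl_closed S"
proof -
  have "reflect (reflect u v) ` A = A" if "norm u = 1" "reflect u ` A = A" "reflect v ` A = A" for u v :: 'a and A
  proof -
    have "reflect (reflect u v) ` A = reflect u ` reflect v ` reflect u ` A"
      using reflect_conjugate[OF that(1), of v] by (simp add: image_image)
    then show ?thesis using that by simp
  qed
  then show ?thesis by (simp add: S_def refl_closed_def norm_reflect)
qed

text \<open>For an involution, preserving a set amounts to mapping it into itself, and for each
  point of the set this is a closed condition on \<open>u\<close>.\<close>

lemma closed_symmetries:
  fixes K L :: "'a::euclidean_space set"
  assumes "closed K" "closed L"
  shows "closed {u. norm u = 1 \<and> reflect u ` K = K \<and> reflect u ` L = L}"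
proof -
  have cont: "continuous_on UNIV (\<lambda>u::'a. reflect u x)" for x
    unfolding reflect_def by (intro continuous_intros)
  have iff: "reflect u ` A = A \<longleftrightarrow> (\<forall>x\<in>A. reflect u x \<in> A)" if "norm u = 1" for u :: 'a and A
    using reflect_image_eqI[OF that, of A] by blast
  have "{u. norm u = 1 \<and> reflect u ` K = K \<and> reflect u ` L = L} =
      {u. norm u = 1 \<and> (\<forall>x\<in>K. reflect u x \<in> K) \<and> (\<forall>x\<in>L. reflect u x \<in> L)}"
    by (rule Collect_cong) (simp add: iff cong: conj_cong)
  also have "\<dots> = sphere 0 1 \<inter> (\<Inter>x\<in>K. (\<lambda>u. reflect u x) -` K) \<inter> (\<Inter>x\<in>L. (\<lambda>u. reflect u x) -` L)"
    by auto
  also have "closed \<dots>"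
    using assms cont by (intro closed_Int closed_INT ballI closed_vimage) auto
  finally show ?thesis .
qed

lemma orthogonal_inv_image:
  assumes "orthogonal_transformation g" "g ` A = A"
  shows "inv g ` A = A"
  using assms by (metis image_inv_f_f orthogonal_transformation_inj)

lemma finite_reflection_group_of_symmetries:
  fixes K L :: "'a::euclidean_space set"
  assumes "closed K" "closed L"
    and span: "span {u. norm u = 1 \<and> reflect u ` K = K \<and> reflect u ` L = L} = UNIV"
  shows "\<exists>R G p. finite_reflection_group R G p \<and>
    (\<forall>g\<in>G. g ` K = K \<and> g ` L = L)"
proof -
  define S where "S = {u. norm u = 1 \<and> reflect u ` K = K \<and> reflect u ` L = L}"
  have "refl_closed S" "closed S" unfolding S_def using refl_closed_symmetries closed_symmetries assms by blast+
  then obtain R where R: "R \<subseteq> S" "finite R" "refl_closed R" "S \<subseteq> span R"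
    using refl_closed_finite_subsystem by blast
  have spanR: "span R = UNIV" using span R(4) unfolding S_def[symmetric]
    by (metis span_minimal subspace_span top.extremum_unique)
  have nR: "norm r = 1" if "r \<in> R" for r using R(3) that refl_closedD by blast
  obtain p where p: "\<forall>r\<in>R. p \<bullet> r \<noteq> 0"
    using generic_vector_exists[OF R(2)] nR by (metis norm_zero zero_neq_one)
  \<comment> \<open>For a full stabilizer the group axioms are immediate. Finiteness comes from
    \<open>R\<close>, as \<open>K\<close> and \<open>L\<close> alone may have infinitely many
    symmetries.\<close>
  define G where "G = {g. orthogonal_transformation g \<and> g ` R = R \<and> g ` K = K \<and> g ` L = L}"
  have "finite_reflection_group R G p"
  proof
    show "finite G"
      by (rule finite_subset[OF _ finite_linear_stabilizer[OF R(2) spanR]])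
         (auto simp: G_def orthogonal_transformation_def)
    show "id \<in> G" by (simp add: G_def orthogonal_transformation_id id_def)
    show "g \<circ> h \<in> G" if "g \<in> G" "h \<in> G" for g h
    proof -
      have "(g \<circ> h) ` A = A" if "g ` A = A" "h ` A = A" for A
        using that by (simp only: image_comp[symmetric])
      then show ?thesis using that by (simp add: G_def orthogonal_transformation_compose)
    qed
    show "inv g \<in> G" if "g \<in> G" for g
      using that by (auto simp: G_def orthogonal_inv_image orthogonal_transformation_inv)
    show "reflect r \<in> G" if r: "r \<in> R" for r
    proof -
      have "reflect r ` R = R" using r R(3) refl_closedD by (intro reflect_image_eqI nR) blast+
      moreover have "reflect r \<in> {g. g ` K = K \<and> g ` L = L}" using r R(1) unfolding S_def by blast
      ultimately show ?thesis using nR[OF r] by (simp add: G_def orthogonal_transformation_reflect)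
    qed
  qed (use R(2,3) spanR p in \<open>simp_all add: G_def\<close>)
  moreover have "\<forall>g\<in>G. g ` K = K \<and> g ` L = L" by (simp add: G_def)
  ultimately show ?thesis by blast
qed

lemma coordinates_inner:
  fixes T :: "'a::euclidean_space \<Rightarrow> 'b::real_inner"
  assumes "linear T"
  shows "T s \<bullet> u = (\<Sum>i\<in>Basis. (s \<bullet> i) * (T i \<bullet> u))"
proof -
  have "T s = T (\<Sum>i\<in>Basis. (s \<bullet> i) *\<^sub>R i)" by (simp add: euclidean_representation)
  also have "\<dots> = (\<Sum>i\<in>Basis. (s \<bullet> i) *\<^sub>R T i)"
    using assms by (simp add: linear_sum linear_scale)
  finally show ?thesis by (simp add: inner_sum_left)
qed

lemma emeasure_radial_measure_orthogonal:
  fixes g :: "'a::euclidean_space \<Rightarrow> 'a"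
  assumes g: "orthogonal_transformation g" and mono: "mono_on {0..} \<psi>" and A: "A \<in> sets borel"
  shows "emeasure (radial_measure \<psi>) (g -` A) = emeasure (radial_measure \<psi>) (A :: 'a set)"
proof -
  have w [measurable]: "(\<lambda>x::'a. exp_neg (\<psi> (norm x))) \<in> borel_measurable borel"
    by (rule borel_measurable_exp_neg_norm[OF mono])
  have "continuous_on UNIV g"
    using g by (simp add: orthogonal_transformation_def linear_continuous_on linear_linear)
  then have gm: "g \<in> borel_measurable borel" by (rule borel_measurable_continuous_onI)
  have gA: "g -` A \<in> sets borel" using measurable_sets_borel[OF gm A] by simp
  have f: "(\<lambda>x. exp_neg (\<psi> (norm x)) * indicator A x) \<in> borel_measurable borel" using A by measurable
  have "emeasure (radial_measure \<psi>) (g -` A) = (\<integral>\<^sup>+x. exp_neg (\<psi> (norm (g x))) * indicator A (g x) \<partial>lborel)"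
  proof -
    have "emeasure (radial_measure \<psi>) (g -` A) = (\<integral>\<^sup>+x. exp_neg (\<psi> (norm x)) * indicator (g -` A) x \<partial>lborel)"
      unfolding radial_measure_def using w gA by (intro emeasure_density) simp_all
    then show ?thesis by (simp add: orthogonal_transformation_norm[OF g] indicator_def)
  qed
  also have "\<dots> = (\<integral>\<^sup>+x. exp_neg (\<psi> (norm x)) * indicator A x \<partial>lborel)"
    by (rule nn_integral_lborel_orthogonal[OF g f])
  also have "\<dots> = emeasure (radial_measure \<psi>) A"
    unfolding radial_measure_def using w A by (intro emeasure_density[symmetric]) simp_all
  finally show ?thesis .
qed

context finite_reflection_group
begin

lemma walls_null: "AE x in lborel. x \<notin> walls"
proof -
  have "r \<noteq> 0" if "r \<in> R" for r using refl_closedD(1)[OF R(1) that] by auto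
  then have "negligible walls"
    unfolding walls_def using R(2) by (intro negligible_Union) (auto intro!: negligible_hyperplane)
  moreover have "walls \<in> sets borel"
    unfolding walls_def using R(2) by (intro sets.finite_UN borel_closed closed_hyperplane)
  ultimately have "walls \<in> null_sets lborel"
    by (simp add: negligible_iff_null_sets null_sets_completion_iff)
  then show ?thesis by (rule AE_not_in)
qed

lemma emeasure_radial_chamber_part:
  assumes mono: "mono_on {0..} \<psi>" and S: "S \<in> sets borel" and inv: "\<And>g. g \<in> G \<Longrightarrow> g -` S = S"
  shows "emeasure (radial_measure \<psi>) S =
    ennreal (real (card G) / real mult) * emeasure (radial_measure \<psi>) (S \<inter> chamber)"
proof -
  have w: "(\<lambda>x::'a. exp_neg (\<psi> (norm x))) \<in> borel_measurable lborel"
    using borel_measurable_exp_neg_norm[OF mono] by simp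
  have "of_nat mult * emeasure (radial_measure \<psi>) S = of_nat (card G) * emeasure (radial_measure \<psi>) (S \<inter> chamber)"
  proof (rule emeasure_chamber_part)
    show "AE x in radial_measure \<psi>. x \<notin> walls"
      unfolding radial_measure_def AE_density[OF w] using walls_null by eventually_elim simp
  qed (use S inv emeasure_radial_measure_orthogonal[OF orth mono] in \<open>auto simp: radial_measure_def\<close>)
  then have "ennreal (1 / real mult) * (ennreal (real mult) * emeasure (radial_measure \<psi>) S)
     = ennreal (1 / real mult) * (ennreal (real (card G)) * emeasure (radial_measure \<psi>) (S \<inter> chamber))"
    by (simp add: ennreal_of_nat_eq_real_of_nat)
  moreover have "ennreal (1 / real mult) * ennreal (real mult) = 1"
    "ennreal (1 / real mult) * ennreal (real (card G)) = ennreal (real (card G) / real mult)"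
    using mult_pos by (simp_all flip: ennreal_mult)
  ultimately show ?thesis by (simp add: mult.assoc[symmetric])
qed

lemma gm_le_L0_sum_chamber:
  assumes l: "0 < l" "l < 1" and mono: "mono_on {0..} \<psi>" and conv: "ext_convex_on {0..} \<psi>"
    and K: "compact K" and L: "compact L"
    and inv: "\<And>g. g \<in> G \<Longrightarrow> g ` K = K \<and> g ` L = L"
  shows "gm_le l (emeasure (radial_measure \<psi>) (K \<inter> chamber)) (emeasure (radial_measure \<psi>) (L \<inter> chamber))
    (emeasure (radial_measure \<psi>) (L0_sum l K L \<inter> chamber))"
proof -
  obtain T :: "'a \<Rightarrow> 'a" where T: "linear T" "bij T"
    and acute: "\<And>i j. i \<in> Basis \<Longrightarrow> j \<in> Basis \<Longrightarrow> 0 \<le> T i \<bullet> T j"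
    and T_pos: "\<And>x. (\<forall>r\<in>R. 0 < p \<bullet> r \<longrightarrow> 0 < r \<bullet> T x) \<longleftrightarrow> (\<forall>i\<in>Basis. 0 < x \<bullet> i)"
    and T_nonneg: "\<And>x. (\<forall>r\<in>R. 0 < p \<bullet> r \<longrightarrow> 0 \<le> r \<bullet> T x) \<longleftrightarrow> (\<forall>i\<in>Basis. 0 \<le> x \<bullet> i)"
    using chamber_coordinates[OF R gen] by blast
  have T_chamber: "T x \<in> chamber \<longleftrightarrow> (\<forall>i\<in>Basis. 0 < x \<bullet> i)" for x
    using T_pos by (simp add: chamber_def)
  \<comment> \<open>Nonnegative coordinates describe the closed chamber; these products are the
    weights in both estimates below.\<close>
  have w_nonneg: "0 \<le> T i \<bullet> T v" if "i \<in> Basis" "\<forall>j\<in>Basis. 0 \<le> v \<bullet> j" for i v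
    unfolding inner_commute[of "T i"] coordinates_inner[OF T(1), of v] using that acute by (auto intro!: sum_nonneg)
  define m where "m = (\<lambda>s t. \<Sum>i\<in>Basis. ((s \<bullet> i) powr (1 - l) * (t \<bullet> i) powr l) *\<^sub>R (i::'a))"
  have m_i: "m s t \<bullet> i = (s \<bullet> i) powr (1 - l) * (t \<bullet> i) powr l" if "i \<in> Basis" for s t i
    using that by (simp add: m_def inner_sum_left_Basis)
  define w where "w = (\<lambda>x::'a. exp_neg (\<psi> (norm x)))"
  have w [measurable]: "w \<in> borel_measurable borel"
    unfolding w_def by (rule borel_measurable_exp_neg_norm[OF mono])
  \<comment> \<open>The restriction to the chamber makes \<open>F S (T x)\<close> vanish off the
    positive orthant, as \<open>prekopa_leindler_PiM\<close> demands.\<close>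
  define F where "F = (\<lambda>S x. w x * indicator (S \<inter> chamber) x)"
  have C [measurable]: "chamber \<in> sets borel" using open_chamber by simp
  have F [measurable]: "F S \<in> borel_measurable borel" if "S \<in> sets borel" for S
    unfolding F_def using that by measurable
  have F_int: "emeasure (radial_measure \<psi>) (S \<inter> chamber) = (\<integral>\<^sup>+x. F S x \<partial>lborel)" if "S \<in> sets borel" for S
    unfolding radial_measure_def w_def[symmetric] F_def using w C that by (intro emeasure_density) auto
  have sets: "K \<in> sets borel" "L \<in> sets borel" "L0_sum l K L \<in> sets borel"
    using K L closed_L0_sum by (auto intro: borel_closed compact_imp_closed)
  have key: "gm_le l (F K (T s)) (F L (T t)) (F (L0_sum l K L) (T (m s t)))"
    if s: "\<forall>i\<in>Basis. 0 < s \<bullet> i" and t: "\<forall>i\<in>Basis. 0 < t \<bullet> i" for s t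
  proof (cases "T s \<in> K \<and> T t \<in> L")
    case True
    have m_pos: "\<forall>i\<in>Basis. 0 < m s t \<bullet> i" using s t by (simp add: m_i) (metis less_irrefl mult_pos_pos powr_gt_zero)
    have in_C: "T s \<in> chamber" "T t \<in> chamber" "T (m s t) \<in> chamber"
      using s t m_pos by (simp_all add: T_chamber)
    have "T (m s t) \<in> L0_sum l K L"
      unfolding L0_sum_def
    proof (intro CollectI ballI)
      fix u :: 'a assume u: "u \<in> sphere 0 1"
      \<comment> \<open>The support functions agree at \<open>u\<close> and \<open>g u\<close>, so
        it suffices to bound the larger product with \<open>g u\<close>.\<close>
      obtain g where g: "g \<in> G" "\<And>r. r \<in> R \<Longrightarrow> 0 < p \<bullet> r \<Longrightarrow> 0 \<le> r \<bullet> g u"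
        "T (m s t) \<bullet> u \<le> T (m s t) \<bullet> g u"
        using move_to_chamber[OF in_C(3)] by blast
      obtain v where v: "g u = T v" using T(2) by (metis bij_pointE)
      have v_nn: "\<forall>i\<in>Basis. 0 \<le> v \<bullet> i" using g(2) T_nonneg[of v] v by auto
      have nn: "0 \<le> T a \<bullet> T v" if "\<forall>i\<in>Basis. 0 < a \<bullet> i" for a
        unfolding coordinates_inner[OF T(1), of a "T v"] using that w_nonneg[OF _ v_nn] by (auto intro!: sum_nonneg simp: less_imp_le)
      have "T (m s t) \<bullet> u \<le> T (m s t) \<bullet> T v" using g(3) v by simp
      also have "\<dots> = (\<Sum>i\<in>Basis. (s \<bullet> i) powr (1 - l) * (t \<bullet> i) powr l * (T i \<bullet> T v))"
        unfolding coordinates_inner[OF T(1), of "m s t"] by (simp add: m_i)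
      also have "\<dots> \<le> (T s \<bullet> T v) powr (1 - l) * (T t \<bullet> T v) powr l"
        unfolding coordinates_inner[OF T(1), of s] coordinates_inner[OF T(1), of t]
        using s t w_nonneg[OF _ v_nn] by (intro sum_powr_le l) auto
      also have "\<dots> \<le> support_fun K (T v) powr (1 - l) * support_fun L (T v) powr l"
        using True K L nn[OF s] nn[OF t] l
        by (intro mult_mono powr_mono2 support_fun_upper compact_imp_bounded) auto
      also have "\<dots> = support_fun K u powr (1 - l) * support_fun L u powr l"
        using support_fun_orthogonal[OF orth[OF g(1)]] inv[OF g(1)] by (simp flip: v)
      finally show "T (m s t) \<bullet> u \<le> support_fun K u powr (1 - l) * support_fun L u powr l" .
    qed
    moreover have "norm (T (m s t)) \<le> (1 - l) * norm (T s) + l * norm (T t)"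
    proof -
      let ?z = "T (m s t)"
      have z_nn: "\<forall>i\<in>Basis. 0 \<le> m s t \<bullet> i" using m_pos by (auto simp: less_imp_le)
      \<comment> \<open>Only one factor is expanded. Since the weights
        \<open>T i \<bullet> ?z\<close> are nonnegative, the geometric means may be replaced by
        arithmetic ones; Cauchy--Schwarz then allows a factor \<open>norm ?z\<close> to be
        cancelled.\<close>
      have "?z \<bullet> ?z = (\<Sum>i\<in>Basis. (s \<bullet> i) powr (1 - l) * (t \<bullet> i) powr l * (T i \<bullet> ?z))"
        unfolding coordinates_inner[OF T(1), of "m s t" "T (m s t)"] by (simp add: m_i)
      also have "\<dots> \<le> (\<Sum>i\<in>Basis. ((1 - l) * (s \<bullet> i) + l * (t \<bullet> i)) * (T i \<bullet> ?z))"
        using s t l w_nonneg[OF _ z_nn] by (intro sum_mono mult_right_mono Youngs_inequality_0) auto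
      also have "\<dots> = ((1 - l) *\<^sub>R T s + l *\<^sub>R T t) \<bullet> ?z"
        unfolding inner_add_left inner_scaleR_left coordinates_inner[OF T(1), of s ?z] coordinates_inner[OF T(1), of t ?z]
        by (simp only: sum_distrib_left sum.distrib[symmetric] distrib_right mult.assoc)
      also have "\<dots> \<le> norm ((1 - l) *\<^sub>R T s + l *\<^sub>R T t) * norm ?z" by (rule norm_cauchy_schwarz)
      finally have "norm ?z * norm ?z \<le> norm ((1 - l) *\<^sub>R T s + l *\<^sub>R T t) * norm ?z"
        by (simp add: norm_eq_sqrt_inner)
      then have "norm ?z \<le> norm ((1 - l) *\<^sub>R T s + l *\<^sub>R T t)"
        by (cases "norm ?z = 0") (auto simp: mult_le_cancel_right)
      also have "\<dots> \<le> (1 - l) * norm (T s) + l * norm (T t)"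
        using norm_triangle_ineq[of "(1 - l) *\<^sub>R T s" "l *\<^sub>R T t"] l by simp
      finally show ?thesis .
    qed
    then have "gm_le l (w (T s)) (w (T t)) (w (T (m s t)))"
      unfolding w_def by (intro gm_le_exp_neg l mono conv) auto
    ultimately show ?thesis using True in_C by (simp add: F_def)
  qed (auto simp: F_def)
  obtain c where c: "0 < c" "\<And>f. f \<in> borel_measurable borel \<Longrightarrow>
      (\<integral>\<^sup>+x. f (T x) \<partial>lborel) = ennreal c * (\<integral>\<^sup>+x. f x \<partial>lborel)"
    using linear_change_of_variables_constant[OF T] by blast
  \<comment> \<open>\<open>e\<close> identifies coordinate functions with vectors;
    \<open>lborel\<close> is the image of the product measure under it.\<close>
  define e where "e = (\<lambda>f. \<Sum>b\<in>Basis. f b *\<^sub>R (b::'a))"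
  have e_i: "e f \<bullet> b = f b" if "b \<in> Basis" for f b using that by (simp add: e_def inner_sum_left_Basis)
  have e_meas: "e \<in> measurable (\<Pi>\<^sub>M b\<in>Basis. lborel) borel"
    unfolding e_def by measurable
  have T_meas: "T \<in> borel_measurable borel"
    using T(1) by (intro borel_measurable_continuous_onI linear_continuous_on) (simp add: linear_linear)
  have FT: "(\<lambda>x. F S (T x)) \<in> borel_measurable borel" if "S \<in> sets borel" for S
    using measurable_compose[OF T_meas F[OF that]] .
  have FTe: "(\<lambda>f. F S (T (e f))) \<in> borel_measurable (\<Pi>\<^sub>M b\<in>Basis. lborel)" if "S \<in> sets borel" for S
    using measurable_compose[OF e_meas FT[OF that]] .
  have int: "(\<integral>\<^sup>+f. F S (T (e f)) \<partial>(\<Pi>\<^sub>M b\<in>Basis. lborel)) = ennreal c * emeasure (radial_measure \<psi>) (S \<inter> chamber)"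
    if S: "S \<in> sets borel" for S
  proof -
    have "ennreal c * (\<integral>\<^sup>+x. F S x \<partial>lborel) = (\<integral>\<^sup>+x. F S (T x) \<partial>lborel)" by (rule c(2)[OF F[OF S], symmetric])
    also have "\<dots> = (\<integral>\<^sup>+f. F S (T (e f)) \<partial>(\<Pi>\<^sub>M b\<in>Basis. lborel))"
      unfolding lborel_eq[where 'a='a] e_def[symmetric] using e_meas FT[OF S] by (simp add: nn_integral_distr)
    finally show ?thesis by (simp add: F_int[OF S])
  qed
  have zero: "F S (T (e f)) = 0" if "b \<in> Basis" "f b \<le> 0" for S f b
    using that T_chamber[of "e f"] e_i by (auto simp: F_def indicator_def not_less)
  have "gm_le l (\<integral>\<^sup>+f. F K (T (e f)) \<partial>(\<Pi>\<^sub>M b\<in>Basis. lborel)) (\<integral>\<^sup>+f. F L (T (e f)) \<partial>(\<Pi>\<^sub>M b\<in>Basis. lborel))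
    (\<integral>\<^sup>+f. F (L0_sum l K L) (T (e f)) \<partial>(\<Pi>\<^sub>M b\<in>Basis. lborel))"
  proof (rule prekopa_leindler_PiM)
    fix x y :: "'a \<Rightarrow> real"
    assume xy: "\<forall>i\<in>Basis. 0 < x i" "\<forall>i\<in>Basis. 0 < y i"
    have "e (\<lambda>i\<in>Basis. x i powr (1 - l) * y i powr l) = m (e x) (e y)"
      by (rule euclidean_eqI) (simp add: e_i m_i)
    then show "gm_le l (F K (T (e x))) (F L (T (e y))) (F (L0_sum l K L) (T (e (\<lambda>i\<in>Basis. x i powr (1 - l) * y i powr l))))"
      using key[of "e x" "e y"] xy by (simp add: e_i)
  qed (use FTe sets zero l in auto)
  then show ?thesis unfolding int[OF sets(1)] int[OF sets(2)] int[OF sets(3)]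
    by (rule gm_le_cancel) (rule c(1))
qed

text \<open>Moving both \<open>u\<close> and a point of \<open>S\<close> into the closed chamber
  makes their product nonnegative. Monotonicity of \<open>powr\<close> in
  \<open>bounded_L0_sum\<close> relies on this sign.\<close>

lemma support_fun_nonneg:
  assumes S: "bounded S" "S \<noteq> {}" and inv: "\<And>g. g \<in> G \<Longrightarrow> g ` S = S"
  shows "0 \<le> support_fun S u"
proof -
  obtain T :: "'a \<Rightarrow> 'a" where T: "linear T" "bij T"
    and acute: "\<And>i j. i \<in> Basis \<Longrightarrow> j \<in> Basis \<Longrightarrow> 0 \<le> T i \<bullet> T j"
    and T_nonneg: "\<And>x. (\<forall>r\<in>R. 0 < p \<bullet> r \<longrightarrow> 0 \<le> r \<bullet> T x) \<longleftrightarrow> (\<forall>i\<in>Basis. 0 \<le> x \<bullet> i)"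
    using chamber_coordinates[OF R gen] by blast
  obtain y where y: "y \<in> S" using S by blast
  obtain g h where g: "g \<in> G" "\<And>r. r \<in> R \<Longrightarrow> 0 < p \<bullet> r \<Longrightarrow> 0 \<le> r \<bullet> g u"
    and h: "h \<in> G" "\<And>r. r \<in> R \<Longrightarrow> 0 < p \<bullet> r \<Longrightarrow> 0 \<le> r \<bullet> h y"
    using move_to_chamber[OF p_chamber] by metis
  obtain a b where ab: "g u = T a" "h y = T b" using T(2) by (metis bij_pointE)
  have nn: "\<forall>i\<in>Basis. 0 \<le> a \<bullet> i" "\<forall>i\<in>Basis. 0 \<le> b \<bullet> i"
    using g(2) h(2) T_nonneg[of a] T_nonneg[of b] ab by auto
  have "0 \<le> T i \<bullet> T a" if "i \<in> Basis" for i
    unfolding inner_commute[of "T i"] coordinates_inner[OF T(1), of a] using that nn(1) acute by (auto intro!: sum_nonneg)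
  then have "0 \<le> T b \<bullet> T a"
    unfolding coordinates_inner[OF T(1), of b] using nn(2) by (auto intro!: sum_nonneg)
  also have "\<dots> \<le> support_fun S (g u)"
  proof -
    have "h y \<in> S" using y inv[OF h(1)] by blast
    from support_fun_upper[OF S(1) this, of "g u"] show ?thesis by (simp add: ab)
  qed
  also have "\<dots> = support_fun S u" by (rule support_fun_orthogonal[OF orth[OF g(1)] inv[OF g(1)]])
  finally show ?thesis .
qed

text \<open>A point is tested against its own direction. Boundedness guards against
  \<open>measure\<close> taking its default value 0 on a set of infinite measure.\<close>

lemma bounded_L0_sum:
  assumes l: "0 < l" "l < 1" and K: "bounded K" "K \<noteq> {}" and L: "bounded L" "L \<noteq> {}"
    and inv: "\<And>g. g \<in> G \<Longrightarrow> g ` K = K \<and> g ` L = L"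
  shows "bounded (L0_sum l K L)"
proof -
  obtain A where A: "\<And>y. y \<in> K \<Longrightarrow> norm y \<le> A" using K(1) by (auto simp: bounded_iff)
  obtain B where B: "\<And>y. y \<in> L \<Longrightarrow> norm y \<le> B" using L(1) by (auto simp: bounded_iff)
  have "norm x \<le> A powr (1 - l) * B powr l" if x: "x \<in> L0_sum l K L" for x
  proof (cases "x = 0")
    case False
    let ?u = "(1 / norm x) *\<^sub>R x"
    have u: "norm ?u = 1" using False by simp
    have "norm x = x \<bullet> ?u" using False by (simp add: dot_square_norm power2_eq_square)
    also have "\<dots> \<le> support_fun K ?u powr (1 - l) * support_fun L ?u powr l"
      using x u unfolding L0_sum_def by (metis (no_types, lifting) mem_Collect_eq mem_sphere_0)
    also have "\<dots> \<le> A powr (1 - l) * B powr l"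
      using l support_fun_nonneg[OF K, of ?u] support_fun_nonneg[OF L, of ?u] inv
        support_fun_le[OF A K(2) u] support_fun_le[OF B L(2) u]
      by (intro mult_mono powr_mono2) auto
    finally show ?thesis .
  qed simp
  then show ?thesis by (auto simp: bounded_iff)
qed

lemma orthogonal_vimage_eq: "g \<in> G \<Longrightarrow> g ` S = S \<Longrightarrow> g -` S = S"
  using orthogonal_transformation_inj[OF orth] by (metis inj_vimage_image_eq)

theorem measure_L0_sum_ge:
  assumes l: "0 < l" "l < 1" and mono: "mono_on {0..} \<psi>" and conv: "ext_convex_on {0..} \<psi>"
    and K: "compact K" "K \<noteq> {}" and L: "compact L" "L \<noteq> {}"
    and inv: "\<And>g. g \<in> G \<Longrightarrow> g ` K = K \<and> g ` L = L"
  shows "measure (radial_measure \<psi>) K powr (1 - l) * measure (radial_measure \<psi>) L powr l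
    \<le> measure (radial_measure \<psi>) (L0_sum l K L)"
proof -
  have sets: "K \<in> sets borel" "L \<in> sets borel" "L0_sum l K L \<in> sets borel"
    using K L closed_L0_sum by (auto intro: borel_closed compact_imp_closed)
  have bdd: "bounded K" "bounded L" "bounded (L0_sum l K L)"
    using K L bounded_L0_sum[OF l _ K(2) _ L(2) inv] by (auto intro: compact_imp_bounded)
  have vim: "g -` K = K" "g -` L = L" "g -` L0_sum l K L = L0_sum l K L" if "g \<in> G" for g
    using orthogonal_vimage_eq[OF that] L0_sum_orthogonal[OF orth[OF that]] inv[OF that] by auto
  have "0 < real (card G) / real mult"
  proof -
    have "G \<noteq> {}" using id_G by blast
    then have "0 < card G" using finite_G by (simp add: card_gt_0_iff)
    then show ?thesis using mult_pos by simp
  qed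
  from gm_le_cmult[OF gm_le_L0_sum_chamber[OF l mono conv K(1) L(1) inv] this]
  have gm: "gm_le l (emeasure (radial_measure \<psi>) K) (emeasure (radial_measure \<psi>) L) (emeasure (radial_measure \<psi>) (L0_sum l K L))"
    using sets vim by (simp add: emeasure_radial_chamber_part[OF mono])
  have "\<psi> 0 \<noteq> -\<infinity>" using conv by (auto simp: ext_convex_on_def)
  then have "emeasure (radial_measure \<psi>) S = ennreal (measure (radial_measure \<psi>) S)"
    if "bounded S" "S \<in> sets borel" for S :: "'a set"
    using emeasure_radial_measure_bounded[OF mono _ that] by (intro emeasure_eq_ennreal_measure) auto
  then show ?thesis using gm sets bdd by (intro gm_le_ennreal) auto
qed

end

theorem theorem9:
  fixes lam :: real
    and \<psi> :: "real \<Rightarrow> ereal"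
    and H :: "'n::finite \<Rightarrow> (real ^ 'n) set"
    and K L :: "(real ^ 'n) set"
  assumes "0 < lam" and "lam < 1"
    and "mono_on {0..} \<psi>"
    and "ext_convex_on {0..} \<psi>"
    and "\<And>i. linear_hyperplane (H i)"
    and "(\<Inter>i. H i) = {0}"
    and "convex_body K" and "convex_body L"
    and "\<And>i. orth_reflection (H i) ` K = K"
    and "\<And>i. orth_reflection (H i) ` L = L"
  shows "measure (radial_measure \<psi>) (L0_sum lam K L)
      \<ge> measure (radial_measure \<psi>) K powr (1 - lam) * measure (radial_measure \<psi>) L powr lam"
proof -
  define S where "S = {u. norm u = 1 \<and> reflect u ` K = K \<and> reflect u ` L = L}"
  have "\<exists>u. u \<in> S \<and> H i = {x. u \<bullet> x = 0}" for i
  proof -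
    obtain a where a: "a \<noteq> 0" "H i = {x. a \<bullet> x = 0}"
      using assms(5)[of i] unfolding linear_hyperplane_def by blast
    define u where "u = (1 / norm a) *\<^sub>R a"
    have "orth_reflection (H i) x = reflect u x" for x
      using a by (simp add: orth_reflection_hyperplane reflect_def u_def dot_square_norm power2_eq_square)
    then have "orth_reflection (H i) = reflect u" by (rule ext)
    then have "u \<in> S" using assms(9,10)[of i] a by (simp add: S_def u_def)
    then show ?thesis using a by (intro exI[of _ u]) (simp add: u_def)
  qed
  then obtain u where u: "\<And>i. u i \<in> S" "\<And>i. H i = {x. u i \<bullet> x = 0}" by metis
  have span: "span S = UNIV"
  proof (rule ccontr)
    assume "span S \<noteq> UNIV"
    then obtain a where a: "a \<noteq> 0" "span S \<subseteq> {x. a \<bullet> x = 0}"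
      using span_not_univ_subset_hyperplane by blast
    \<comment> \<open>A vector orthogonal to all of \<open>S\<close> is orthogonal to each
      \<open>u i\<close>, hence lies in every \<open>H i\<close>.\<close>
    have "a \<in> (\<Inter>i. H i)"
      using a(2) u span_base by (fastforce simp: inner_commute)
    then show False using assms(6) a(1) by simp
  qed
  have KL: "compact K" "K \<noteq> {}" "compact L" "L \<noteq> {}"
    using assms(7,8) interior_empty unfolding convex_body_def by auto
  obtain R G p where "finite_reflection_group R G p" and inv: "\<forall>g\<in>G. g ` K = K \<and> g ` L = L"
    using finite_reflection_group_of_symmetries[OF compact_imp_closed[OF KL(1)] compact_imp_closed[OF KL(3)]] span
    unfolding S_def by blast
  then interpret finite_reflection_group R G p by blast
  show ?thesis using measure_L0_sum_ge[OF assms(1-4) KL] inv by blast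
qed

end
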